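(* Let $K$ be an algebraically closed field, let $k$ be a positive integer, and let $r\ge 2$ and $n\ge 2r+4$ be integers. Then the pfaffian jet variety $\mathcal{P}^{n,k}_r$ has at least $\lfloor k/2\rfloor+1$ irreducible components.
   Context: Let $K$ be an algebraically closed field and $n,k,r$ positive integers with $2r\le n$. Let $A^{n,k}=K[x_{ij}^{(h)} : 1\le i<j\le n,\ h=0,\ldots,k-1]$, a polynomial ring in $kn(n-1)/2$ variables. Let $t$ be a further indeterminate and let $X(t)$ be the $n\times n$ skew-symmetric matrix (zero diagonal) with entries $x_{ij}(t)=x_{ij}^{(0)}+x_{ij}^{(1)}t+\cdots+x_{ij}^{(k-1)}t^{k-1}$ for $i<j$ and $x_{ji}(t)=-x_{ij}(t)$. A $2r$-pfaffian of $X(t)$ is the pfaffian of a submatrix of $X(t)$ with rows and columns $a_1<\cdots<a_{2r}$. Write a $2r$-pfaffian as $p=\sum_{h\ge 0}p^{(h)}t^h$ with $p^{(h)}\in A^{n,k}$. The pfaffian jet ideal $I^{n,k}_r\subseteq A^{n,k}$ is the ideal generated by $p^{(h)}$ for all $2r$-pfaffians $p$ of $X(t)$ and all $h=0,\ldots,k-1$. The pfaffian jet variety is the zero locus $\mathcal{P}^{n,k}_r=\mathbb{V}(I^{n,k}_r)\subseteq\mathbb{A}_K^{kn(n-1)/2}$. *)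

theory Defs
  imports
    "HOL-Library.Poly_Mapping"
    "HOL-Computational_Algebra.Polynomial"
    "HOL-Combinatorics.Permutations"
    "HOL-Algebra.Ideal"
    "HOL-Analysis.Abstract_Topology"
begin

section \<open>Multivariate polynomials and the Zariski topology\<close>

text \<open>
  A monomial is a finitely supported exponent function \<^typ>\<open>'v \<Rightarrow>\<^sub>0 nat\<close>. The type \<open>('v, 'a) mpol\<close>
  has every element of \<^typ>\<open>'v\<close> as a variable; \<open>pol_carrier V\<close> cuts out \<open>K[V]\<close>.
\<close>

type_synonym ('v, 'a) mpol = "('v \<Rightarrow>\<^sub>0 nat) \<Rightarrow>\<^sub>0 'a"

definition pvar :: "'v \<Rightarrow> ('v, 'a::comm_ring_1) mpol" where
  "pvar v = Poly_Mapping.single (Poly_Mapping.single v 1) 1"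

definition monom_value :: "('v \<Rightarrow> 'a) \<Rightarrow> ('v \<Rightarrow>\<^sub>0 nat) \<Rightarrow> 'a::comm_ring_1" where
  "monom_value x m = (\<Prod>v\<in>Poly_Mapping.keys m. x v ^ Poly_Mapping.lookup m v)"

definition pol_value :: "('v \<Rightarrow> 'a) \<Rightarrow> ('v, 'a) mpol \<Rightarrow> 'a::comm_ring_1" where
  "pol_value x p = (\<Sum>m\<in>Poly_Mapping.keys p. Poly_Mapping.lookup p m * monom_value x m)"

definition pol_carrier :: "'v set \<Rightarrow> ('v, 'a::comm_ring_1) mpol set" where
  "pol_carrier V = {p. \<forall>m\<in>Poly_Mapping.keys p. Poly_Mapping.keys m \<subseteq> V}"

definition pol_ring :: "'v set \<Rightarrow> ('v, 'a::comm_ring_1) mpol ring" where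
  "pol_ring V = \<lparr>carrier = pol_carrier V, mult = (*), one = 1, zero = 0, add = (+)\<rparr>"

text \<open>Points are extensional functions, so that distinct points differ at some coordinate in \<open>V\<close>.\<close>

definition affine_space :: "'v set \<Rightarrow> ('v \<Rightarrow> 'a) set" where
  "affine_space V = V \<rightarrow>\<^sub>E UNIV"

definition zero_locus :: "'v set \<Rightarrow> ('v, 'a::comm_ring_1) mpol set \<Rightarrow> ('v \<Rightarrow> 'a) set" where
  "zero_locus V S = {x \<in> affine_space V. \<forall>p\<in>S. pol_value x p = 0}"

definition zariski_open :: "'v set \<Rightarrow> ('v \<Rightarrow> 'a::field) set \<Rightarrow> bool" where
  "zariski_open V U \<longleftrightarrow> (\<exists>S \<subseteq> pol_carrier V. U = affine_space V - zero_locus V S)"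

definition zariski :: "'v set \<Rightarrow> ('v \<Rightarrow> 'a::field) topology" where
  "zariski V = topology (zariski_open V)"

lemma monom_value_superset:
  "finite F \<Longrightarrow> Poly_Mapping.keys m \<subseteq> F \<Longrightarrow>
    monom_value x m = (\<Prod>v\<in>F. x v ^ Poly_Mapping.lookup m v)"
  unfolding monom_value_def by (rule prod.mono_neutral_left) (auto simp: in_keys_iff)

lemma monom_value_add: "monom_value x (m + m') = monom_value x m * monom_value x m'"
proof -
  let ?F = "Poly_Mapping.keys m \<union> Poly_Mapping.keys m'"
  have "Poly_Mapping.keys (m + m') \<subseteq> ?F" by (rule keys_add)
  then show ?thesis
    by (simp add: monom_value_superset[of ?F] lookup_add power_add prod.distrib)
qed

lemma pol_value_superset:
  "finite F \<Longrightarrow> Poly_Mapping.keys p \<subseteq> F \<Longrightarrow>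
    pol_value x p = (\<Sum>m\<in>F. Poly_Mapping.lookup p m * monom_value x m)"
  unfolding pol_value_def by (rule sum.mono_neutral_left) (auto simp: in_keys_iff)

lemma pol_value_0 [simp]: "pol_value x 0 = 0"
  by (simp add: pol_value_def)

lemma pol_value_single [simp]:
  "pol_value x (Poly_Mapping.single m c) = c * monom_value x m"
  by (simp add: pol_value_superset[of "{m}"])

lemma pol_value_1 [simp]: "pol_value x 1 = 1"
  by (simp add: monom_value_def flip: single_one)

lemma pol_value_pvar [simp]: "pol_value x (pvar v) = x v"
  by (simp add: pvar_def monom_value_def)

lemma pol_value_add: "pol_value x (p + q) = pol_value x p + pol_value x q"
proof -
  let ?F = "Poly_Mapping.keys p \<union> Poly_Mapping.keys q"
  have "Poly_Mapping.keys (p + q) \<subseteq> ?F" by (rule keys_add)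
  then show ?thesis
    by (simp add: pol_value_superset[of ?F] lookup_add distrib_right sum.distrib)
qed

lemma mpol_induct [case_names zero single_add]:
  fixes p :: "('v, 'a::comm_ring_1) mpol"
  assumes "P 0" "\<And>m c p. P p \<Longrightarrow> P (Poly_Mapping.single m c + p)"
  shows "P p"
proof (induction p rule: update_induct)
  case const then show ?case by (fact assms(1))
next
  case (update f a b)
  have "Poly_Mapping.update a b f = Poly_Mapping.single a b + f"
    using update(1) by (intro poly_mapping_eqI)
      (auto simp: lookup_update lookup_add lookup_single when_def in_keys_iff)
  then show ?case using assms(2)[OF update(3)] by metis
qed

lemma pol_value_mult: "pol_value x (p * q) = pol_value x p * pol_value x q"
proof (induction p rule: mpol_induct)
  case zero then show ?case by simp
next
  case (single_add m c p)
  have "pol_value x (Poly_Mapping.single m c * q) = c * monom_value x m * pol_value x q"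
    by (induction q rule: mpol_induct)
      (simp_all add: distrib_left pol_value_add mult_single monom_value_add mult_ac)
  with single_add show ?case by (simp add: distrib_right pol_value_add)
qed

lemma pol_carrier_closed:
  "0 \<in> pol_carrier V" "1 \<in> pol_carrier V"
  "p \<in> pol_carrier V \<Longrightarrow> - p \<in> pol_carrier V"
  "p \<in> pol_carrier V \<Longrightarrow> q \<in> pol_carrier V \<Longrightarrow> p + q \<in> pol_carrier V"
  "p \<in> pol_carrier V \<Longrightarrow> q \<in> pol_carrier V \<Longrightarrow> p * q \<in> pol_carrier V"
  "v \<in> V \<Longrightarrow> pvar v \<in> pol_carrier V"
proof -
  show "0 \<in> pol_carrier V" "1 \<in> pol_carrier V" "v \<in> V \<Longrightarrow> pvar v \<in> pol_carrier V"
    by (auto simp: pol_carrier_def pvar_def)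
  show "p \<in> pol_carrier V \<Longrightarrow> - p \<in> pol_carrier V"
    by (simp add: pol_carrier_def in_keys_iff)
  assume p: "p \<in> pol_carrier V" and q: "q \<in> pol_carrier V"
  show "p + q \<in> pol_carrier V"
    using keys_add[of p q] p q unfolding pol_carrier_def by blast
  show "p * q \<in> pol_carrier V"
    unfolding pol_carrier_def
  proof (intro CollectI ballI)
    fix m assume "m \<in> Poly_Mapping.keys (p * q)"
    then obtain a b where "a \<in> Poly_Mapping.keys p" "b \<in> Poly_Mapping.keys q" "m = a + b"
      using keys_mult[of p q] by blast
    then show "Poly_Mapping.keys m \<subseteq> V"
      using keys_add[of a b] p q unfolding pol_carrier_def by blast
  qed
qed

lemma cring_pol_ring: "cring (pol_ring V)"
proof (rule cringI)
  show "abelian_group (pol_ring V)"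
  proof (rule abelian_groupI)
    fix p assume "p \<in> carrier (pol_ring V)"
    then show "\<exists>q\<in>carrier (pol_ring V). q \<oplus>\<^bsub>pol_ring V\<^esub> p = \<zero>\<^bsub>pol_ring V\<^esub>"
      by (intro bexI[of _ "- p"]) (auto simp: pol_ring_def pol_carrier_closed)
  qed (auto simp: pol_ring_def pol_carrier_closed algebra_simps)
  show "Group.comm_monoid (pol_ring V)"
    by (rule comm_monoidI) (auto simp: pol_ring_def pol_carrier_closed algebra_simps)
qed (auto simp: pol_ring_def algebra_simps)

lemma istopology_zariski_open:
  "istopology (zariski_open V :: ('v \<Rightarrow> 'a::field) set \<Rightarrow> bool)"
  unfolding istopology_def
proof (intro conjI allI impI)
  fix U W :: "('v \<Rightarrow> 'a) set" assume "zariski_open V U" "zariski_open V W"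
  then obtain S T where S: "S \<subseteq> pol_carrier V" "U = affine_space V - zero_locus V S"
    and T: "T \<subseteq> pol_carrier V" "W = affine_space V - zero_locus V T"
    unfolding zariski_open_def by blast
  let ?R = "{p * q |p q. p \<in> S \<and> q \<in> T}"
  have "?R \<subseteq> pol_carrier V" using S T pol_carrier_closed(5) by blast
  moreover have "U \<inter> W = affine_space V - zero_locus V ?R"
  proof (intro equalityI subsetI)
    fix x assume x: "x \<in> U \<inter> W"
    then obtain p q where "p \<in> S" "q \<in> T" "pol_value x p \<noteq> 0" "pol_value x q \<noteq> 0"
      unfolding S T zero_locus_def by blast
    then have "p * q \<in> ?R" "pol_value x (p * q) \<noteq> 0" by (auto simp: pol_value_mult)
    then show "x \<in> affine_space V - zero_locus V ?R"
      using x unfolding S T zero_locus_def by blast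
  next
    fix x assume x: "x \<in> affine_space V - zero_locus V ?R"
    then obtain p q where "p \<in> S" "q \<in> T" "pol_value x (p * q) \<noteq> 0"
      unfolding zero_locus_def by blast
    then have "p \<in> S" "q \<in> T" "pol_value x p \<noteq> 0" "pol_value x q \<noteq> 0"
      by (auto simp: pol_value_mult)
    then show "x \<in> U \<inter> W" using x unfolding S T zero_locus_def by blast
  qed
  ultimately show "zariski_open V (U \<inter> W)" unfolding zariski_open_def by blast
next
  fix \<K> :: "('v \<Rightarrow> 'a) set set" assume "\<forall>U\<in>\<K>. zariski_open V U"
  then have "\<exists>S. \<forall>U\<in>\<K>. S U \<subseteq> pol_carrier V \<and> U = affine_space V - zero_locus V (S U)"
    unfolding zariski_open_def by (intro bchoice) blast
  then obtain S where S: "\<And>U. U \<in> \<K> \<Longrightarrow> S U \<subseteq> pol_carrier V"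
    "\<And>U. U \<in> \<K> \<Longrightarrow> U = affine_space V - zero_locus V (S U)"
    by blast
  have "\<Union>\<K> = (\<Union>U\<in>\<K>. affine_space V - zero_locus V (S U))"
    using S(2) by blast
  also have "\<dots> = affine_space V - zero_locus V (\<Union>U\<in>\<K>. S U)"
    unfolding zero_locus_def by blast
  finally show "zariski_open V (\<Union>\<K>)"
    using UN_least[of \<K> S "pol_carrier V", OF S(1)] unfolding zariski_open_def by blast
qed

lemma openin_zariski: "openin (zariski V) U \<longleftrightarrow> zariski_open V U"
  by (simp add: zariski_def istopology_zariski_open)

lemma topspace_zariski: "topspace (zariski V) = (affine_space V :: ('v \<Rightarrow> 'a::field) set)"
proof -
  have "zariski_open V (affine_space V :: ('v \<Rightarrow> 'a) set)"
    unfolding zariski_open_def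
    by (rule exI[of _ "{1}"]) (auto simp: zero_locus_def pol_carrier_closed)
  moreover have "U \<subseteq> affine_space V" if "zariski_open V U" for U :: "('v \<Rightarrow> 'a) set"
    using that unfolding zariski_open_def by auto
  ultimately show ?thesis
    unfolding topspace_def openin_zariski by blast
qed

lemma closedin_zariski:
  fixes Z :: "('v \<Rightarrow> 'a::field) set"
  shows "closedin (zariski V) Z \<longleftrightarrow> (\<exists>S \<subseteq> pol_carrier V. Z = zero_locus V S)"
proof -
  have sub: "zero_locus V S \<subseteq> affine_space V" for S :: "('v, 'a) mpol set"
    by (auto simp: zero_locus_def)
  show ?thesis
    unfolding closedin_def topspace_zariski openin_zariski zariski_open_def
    using sub by blast
qed

definition irreducible_in :: "'a topology \<Rightarrow> 'a set \<Rightarrow> bool" where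
  "irreducible_in X S \<longleftrightarrow> S \<subseteq> topspace X \<and> S \<noteq> {} \<and>
     (\<forall>C D. closedin X C \<longrightarrow> closedin X D \<longrightarrow> S \<subseteq> C \<union> D \<longrightarrow> S \<subseteq> C \<or> S \<subseteq> D)"

definition irreducible_components_of :: "'a topology \<Rightarrow> 'a set set" where
  "irreducible_components_of X =
     {S. irreducible_in X S \<and> (\<forall>T. irreducible_in X T \<longrightarrow> S \<subseteq> T \<longrightarrow> T = S)}"

section \<open>Pfaffian jet varieties\<close>

text \<open>
  The pfaffian of a \<open>2r \<times> 2r\<close> skew-symmetric matrix with rows and columns \<open>1, \<dots>, 2r\<close>: the sum
  over the perfect matchings \<open>{\<sigma> 1, \<sigma> 2}, \<dots>, {\<sigma> (2r-1), \<sigma> (2r)}\<close>, each represented by its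
  unique permutation with \<open>\<sigma> (2i-1) < \<sigma> (2i)\<close> and \<open>\<sigma> 1 < \<sigma> 3 < \<dots> < \<sigma> (2r-1)\<close>. Unlike the sum
  over all permutations divided by \<open>2^r r!\<close>, this makes sense in every characteristic.
\<close>

definition pfaffian :: "nat \<Rightarrow> (nat \<Rightarrow> nat \<Rightarrow> 'b::comm_ring_1) \<Rightarrow> 'b" where
  "pfaffian r B =
     (\<Sum>\<sigma> | \<sigma> permutes {1..2*r} \<and> (\<forall>i\<in>{1..r}. \<sigma> (2*i-1) < \<sigma> (2*i)) \<and>
            (\<forall>i\<in>{1..<r}. \<sigma> (2*i-1) < \<sigma> (2*i+1)).
        of_int (sign \<sigma>) * (\<Prod>i=1..r. B (\<sigma> (2*i-1)) (\<sigma> (2*i))))"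

text \<open>The triple \<open>(i, j, h)\<close> names the variable \<open>x\<^sub>i\<^sub>j\<^sup>(\<^sup>h\<^sup>)\<close>.\<close>

definition jet_vars :: "nat \<Rightarrow> nat \<Rightarrow> (nat \<times> nat \<times> nat) set" where
  "jet_vars n k = {(i, j, h). 1 \<le> i \<and> i < j \<and> j \<le> n \<and> h < k}"

definition jet_entry :: "nat \<Rightarrow> nat \<Rightarrow> nat \<Rightarrow> (nat \<times> nat \<times> nat, 'a::comm_ring_1) mpol poly" where
  "jet_entry k i j = (\<Sum>h<k. Polynomial.monom (pvar (i, j, h)) h)"

definition jet_matrix :: "nat \<Rightarrow> nat \<Rightarrow> nat \<Rightarrow> (nat \<times> nat \<times> nat, 'a::comm_ring_1) mpol poly" where
  "jet_matrix k i j =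
     (if i < j then jet_entry k i j else if j < i then - jet_entry k j i else 0)"

text \<open>The sequence \<open>a 1 < \<dots> < a (2r)\<close> selects the rows and columns of the submatrix.\<close>

definition jet_pfaffians :: "nat \<Rightarrow> nat \<Rightarrow> nat \<Rightarrow> (nat \<times> nat \<times> nat, 'a::comm_ring_1) mpol poly set" where
  "jet_pfaffians n k r =
     {pfaffian r (\<lambda>i j. jet_matrix k (a i) (a j)) |a.
        strict_mono_on {1..2*r} a \<and> a ` {1..2*r} \<subseteq> {1..n}}"

definition pfaffian_jet_ideal :: "nat \<Rightarrow> nat \<Rightarrow> nat \<Rightarrow> (nat \<times> nat \<times> nat, 'a::comm_ring_1) mpol set" where
  "pfaffian_jet_ideal n k r =
     Idl\<^bsub>pol_ring (jet_vars n k)\<^esub> {Polynomial.coeff p h |p h. p \<in> jet_pfaffians n k r \<and> h < k}"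

definition pfaffian_jet_variety :: "nat \<Rightarrow> nat \<Rightarrow> nat \<Rightarrow> (nat \<times> nat \<times> nat \<Rightarrow> 'a::comm_ring_1) set" where
  "pfaffian_jet_variety n k r = zero_locus (jet_vars n k) (pfaffian_jet_ideal n k r)"

end

theory Submission
  imports Defs
begin

text \<open>
  Let \<open>d \<le> k div 2\<close> and let \<open>p\<^sub>d\<close> be the point of the variety given by the block diagonal matrix with
  \<open>r + 1\<close> nonzero \<open>2 \<times> 2\<close> blocks of \<open>t\<close>-adic orders \<open>k - d, k - d, d, 0, \<dots>, 0\<close>. The components through
  \<open>p\<^sub>0, p\<^sub>1, \<dots>\<close> are pairwise distinct. Indeed, let \<open>I = {5, \<dots>, 2r+2}\<close> and \<open>J = {1, \<dots>, 2r+2}\<close>. The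
  Pluecker relation writes \<open>Pf\<^sub>I Pf\<^sub>J\<close> as a sum of products of two \<open>2r\<close>-pfaffians, so it vanishes modulo
  \<open>t\<^sup>2\<^sup>k\<close> on the variety. Hence the variety is covered by the closed sets \<open>Pf\<^sub>I \<equiv> 0\<close> mod \<open>t\<^sup>d\<close> and
  the vanishing of the coefficient of index \<open>2k - d\<close> in \<open>Pf\<^sub>J\<close>. At \<open>p\<^sub>e\<close> the order of \<open>Pf\<^sub>I\<close> is
  exactly \<open>e\<close>, and for \<open>d > 0\<close> the order of \<open>Pf\<^sub>J\<close> at \<open>p\<^sub>d\<close> is \<open>2k - d\<close>. So for \<open>e < d\<close> the first
  closed set misses \<open>p\<^sub>e\<close> and the second misses \<open>p\<^sub>d\<close>, and no irreducible subset of the variety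
  contains both points.
\<close>

section \<open>Irreducible components\<close>

text \<open>Zorn's lemma for the irreducible sets through \<open>x\<close>. The union of a chain is
  irreducible: if one member leaves \<open>C\<close> and another leaves \<open>D\<close>, the larger
  of the two leaves both.\<close>

lemma irreducible_component_exists:
  assumes x: "x \<in> topspace X"
  shows "\<exists>Z \<in> irreducible_components_of X. x \<in> Z"
proof -
  let ?\<A> = "{S. irreducible_in X S \<and> x \<in> S}"
  have "irreducible_in X {x}"
    using x by (auto simp: irreducible_in_def)
  then have "?\<A> \<noteq> {}" by blast
  moreover have "\<Union>\<C> \<in> ?\<A>" if "\<C> \<noteq> {}" and chain: "subset.chain ?\<A> \<C>" for \<C>
  proof -
    have irr: "irreducible_in X T" "x \<in> T" if "T \<in> \<C>" for T
      using chain that by (auto simp: subset.chain_def)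
    have "\<Union>\<C> \<subseteq> C \<or> \<Union>\<C> \<subseteq> D"
      if CD: "closedin X C" "closedin X D" "\<Union>\<C> \<subseteq> C \<union> D" for C D
    proof (rule ccontr)
      assume "\<not> ?thesis"
      then obtain S T where "S \<in> \<C>" "T \<in> \<C>" "\<not> S \<subseteq> C" "\<not> T \<subseteq> D" by blast
      moreover have "S \<subseteq> T \<or> T \<subseteq> S"
        using chain \<open>S \<in> \<C>\<close> \<open>T \<in> \<C>\<close> by (auto simp: subset.chain_def)
      ultimately obtain U where "U \<in> \<C>" "\<not> U \<subseteq> C" "\<not> U \<subseteq> D" by blast
      moreover have "U \<subseteq> C \<union> D" using \<open>U \<in> \<C>\<close> CD(3) by blast
      ultimately show False
        using irr(1)[of U] CD(1,2) unfolding irreducible_in_def by blast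
    qed
    moreover have "\<Union>\<C> \<subseteq> topspace X"
      using irr(1) unfolding irreducible_in_def by blast
    moreover have "x \<in> \<Union>\<C>"
      using irr(2) \<open>\<C> \<noteq> {}\<close> by blast
    ultimately show ?thesis
      unfolding irreducible_in_def by auto
  qed
  ultimately have "\<exists>Z\<in>?\<A>. \<forall>S\<in>?\<A>. Z \<subseteq> S \<longrightarrow> S = Z"
    by (rule subset_Zorn_nonempty)
  then obtain Z where Z: "Z \<in> ?\<A>" "\<forall>S\<in>?\<A>. Z \<subseteq> S \<longrightarrow> S = Z"
    by blast
  \<comment> \<open>So far \<open>Z\<close> is maximal only among irreducible sets through
    \<open>x\<close>; every superset of \<open>Z\<close> also contains \<open>x\<close>.\<close>
  have "T = Z" if "irreducible_in X T" "Z \<subseteq> T" for T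
    using Z that by (metis (mono_tags, lifting) mem_Collect_eq subsetD)
  with Z(1) have "Z \<in> irreducible_components_of X"
    unfolding irreducible_components_of_def by simp
  with Z(1) show ?thesis by blast
qed

text \<open>Choose a component through each point. If two choices agreed, irreducibility would put
  that component inside \<open>C\<close> or inside \<open>D\<close>, and each of these misses one of
  the two points. The conclusion names a finite subfamily because \<open>card\<close> is 0 on
  infinite sets.\<close>

lemma card_irreducible_components_ge:
  fixes p :: "nat \<Rightarrow> 'a"
  assumes p: "\<And>d. d \<le> m \<Longrightarrow> p d \<in> topspace X"
    and sep: "\<And>d e. e < d \<Longrightarrow> d \<le> m \<Longrightarrow>
      \<exists>C D. closedin X C \<and> closedin X D \<and> topspace X \<subseteq> C \<union> D \<and> p e \<notin> C \<and> p d \<notin> D"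
  shows "\<exists>\<C> \<subseteq> irreducible_components_of X. finite \<C> \<and> card \<C> = m + 1"
proof -
  have "\<forall>d\<in>{..m}. \<exists>Z. Z \<in> irreducible_components_of X \<and> p d \<in> Z"
    using irreducible_component_exists[of _ X] p by (metis atMost_iff)
  then obtain Z where Z: "\<And>d. d \<le> m \<Longrightarrow> Z d \<in> irreducible_components_of X \<and> p d \<in> Z d"
    by (metis atMost_iff)
  have "Z e \<noteq> Z d" if less: "e < d" "d \<le> m" for d e
  proof
    assume eq: "Z e = Z d"
    obtain C D where CD: "closedin X C" "closedin X D" "topspace X \<subseteq> C \<union> D" "p e \<notin> C" "p d \<notin> D"
      using sep[OF less] by blast
    have "p e \<in> Z d" "p d \<in> Z d" using Z[of d] Z[of e] less eq by auto
    moreover have "irreducible_in X (Z d)"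
      using Z[of d] less by (auto simp: irreducible_components_of_def)
    ultimately show False
      using CD unfolding irreducible_in_def by (metis subset_eq)
  qed
  then have "inj_on Z {..m}"
    by (intro linorder_inj_onI) auto
  then have "card (Z ` {..m}) = m + 1" by (simp add: card_image)
  moreover have "Z ` {..m} \<subseteq> irreducible_components_of X" using Z by auto
  ultimately show ?thesis by blast
qed

section \<open>Pfaffians indexed by lists\<close>

text \<open>The sum of \<open>(-1)\<^sup>i f (xs ! i) ys\<close>, where \<open>ys\<close> is \<open>xs\<close> without its entry number \<open>i\<close>; the recursion
  avoids index arithmetic.\<close>

fun altsum :: "('a \<Rightarrow> 'a list \<Rightarrow> 'b::comm_ring_1) \<Rightarrow> 'a list \<Rightarrow> 'b" where
  "altsum f [] = 0"
| "altsum f (x # xs) = f x xs - altsum (\<lambda>z zs. f z (x # zs)) xs"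

text \<open>As a \<open>fundef_cong\<close> rule, it lets the termination proof of \<open>pf\<close>
  see through its length condition that the recursive calls are on shorter lists.\<close>

lemma altsum_cong [fundef_cong]:
  assumes "xs = ys"
    and "\<And>z zs. z \<in> set ys \<Longrightarrow> set zs \<subseteq> set ys \<Longrightarrow> length ys = Suc (length zs) \<Longrightarrow> f z zs = g z zs"
  shows "altsum f xs = altsum g ys"
  using assms(2) unfolding assms(1)
proof (induction ys arbitrary: f g)
  case (Cons y ys)
  have "altsum (\<lambda>z zs. f z (y # zs)) ys = altsum (\<lambda>z zs. g z (y # zs)) ys"
    by (intro Cons.IH Cons.prems) auto
  moreover have "f y ys = g y ys"
    by (intro Cons.prems) auto
  ultimately show ?case by simp
qed simp

lemma altsum_zero [simp]: "altsum (\<lambda>z zs. 0) xs = 0"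
  by (induction xs) simp_all

lemma altsum_minus: "altsum (\<lambda>z zs. - f z zs) xs = - altsum f xs"
  by (induction xs arbitrary: f) simp_all

lemma altsum_diff: "altsum (\<lambda>z zs. f z zs - g z zs) xs = altsum f xs - altsum g xs"
  by (induction xs arbitrary: f g) simp_all

lemma altsum_mult_left: "altsum (\<lambda>z zs. c * f z zs) xs = c * altsum f xs"
  by (induction xs arbitrary: f) (simp_all add: right_diff_distrib)

lemma altsum_exchange:
  "altsum (\<lambda>z zs. altsum (\<lambda>w ws. h z zs w ws) ys) xs =
   altsum (\<lambda>w ws. altsum (\<lambda>z zs. h z zs w ws) xs) ys"
  by (induction xs arbitrary: h) (simp_all add: altsum_diff)

lemma altsum_eq_0:
  assumes "\<And>z zs. z \<in> set xs \<Longrightarrow> length xs = Suc (length zs) \<Longrightarrow> f z zs = 0"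
  shows "altsum f xs = 0"
proof -
  have "altsum f xs = altsum (\<lambda>z zs. 0) xs"
    using assms by (intro altsum_cong) auto
  then show ?thesis by simp
qed

text \<open>The ordered pairs of selected entries are split by whether the head \<open>x\<close> is
  chosen first, second or not at all.\<close>

lemma altsum_altsum_Cons:
  "altsum (\<lambda>z zs. altsum (g z) zs) (x # xs) =
     altsum (g x) xs - altsum (\<lambda>z zs. g z x zs) xs
       + altsum (\<lambda>z zs. altsum (\<lambda>w ws. g z w (x # ws)) zs) xs"
  by (simp add: altsum_diff)

text \<open>Selecting the same two positions in the opposite order flips the sign. In the induction
  the terms with the head chosen first and second trade places.\<close>

lemma altsum_altsum_antisym:
  "altsum (\<lambda>z zs. altsum (\<lambda>w ws. g w z ws) zs) xs = - altsum (\<lambda>z zs. altsum (g z) zs) xs"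
proof (induction xs arbitrary: g)
  case (Cons x xs)
  show ?case
    unfolding altsum_altsum_Cons Cons.IH[of "\<lambda>z w ws. g z w (x # ws)"] by simp
qed simp

text \<open>Antisymmetry would only show that twice the sum vanishes, which says nothing in
  characteristic 2. The induction instead cancels the terms in pairs.\<close>

lemma altsum_altsum_sym_eq_0:
  assumes "\<And>z w ws. g z w ws = g w z ws"
  shows "altsum (\<lambda>z zs. altsum (g z) zs) xs = 0"
  using assms
proof (induction xs arbitrary: g)
  case (Cons x xs)
  have "altsum (\<lambda>z zs. altsum (\<lambda>w ws. g z w (x # ws)) zs) xs = 0"
    by (rule Cons.IH) (rule Cons.prems)
  moreover have "altsum (g x) xs = altsum (\<lambda>z zs. g z x zs) xs"
    using Cons.prems by (intro altsum_cong) auto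
  ultimately show ?case
    unfolding altsum_altsum_Cons by simp
qed simp

text \<open>The hypothesis handles the terms that keep both \<open>x\<close> and \<open>y\<close>.
  The terms that select \<open>x\<close> or \<open>y\<close> match up with opposite signs, because
  the two positions are adjacent.\<close>

lemma altsum_swap:
  assumes "\<And>z us vs. length xs + length ys = Suc (length us + length vs) \<Longrightarrow>
      f z (us @ x # y # vs) = - f z (us @ y # x # vs)"
  shows "altsum f (xs @ x # y # ys) = - altsum f (xs @ y # x # ys)"
  using assms
proof (induction xs arbitrary: f)
  case Nil
  have "altsum (\<lambda>z zs. f z (x # y # zs)) ys = altsum (\<lambda>z zs. - f z (y # x # zs)) ys"
    using Nil[of "[]"] by (intro altsum_cong) auto
  then show ?case by (simp add: altsum_minus)
next
  case (Cons u xs)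
  have "altsum (\<lambda>z zs. f z (u # zs)) (xs @ x # y # ys) =
      - altsum (\<lambda>z zs. f z (u # zs)) (xs @ y # x # ys)"
    using Cons.prems[of "u # _"] by (intro Cons.IH) auto
  moreover have "f u (xs @ x # y # ys) = - f u (xs @ y # x # ys)"
    by (intro Cons.prems) auto
  ultimately show ?case by simp
qed

section \<open>The recursive pfaffian: alternation and the Pluecker relation\<close>

function pf :: "('a \<Rightarrow> 'a \<Rightarrow> 'b::comm_ring_1) \<Rightarrow> 'a list \<Rightarrow> 'b" where
  "pf B [] = 1"
| "pf B (x # xs) = altsum (\<lambda>z zs. B x z * pf B zs) xs"
  by pat_completeness auto
termination
  by (relation "measure (\<lambda>(B, xs). length xs)") auto

declare pf.simps(2) [simp del]

lemma altsum_map: "altsum f (map a xs) = altsum (\<lambda>z zs. f (a z) (map a zs)) xs"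
  by (induction xs arbitrary: f) simp_all

lemma pf_map: "pf B (map a xs) = pf (\<lambda>i j. B (a i) (a j)) xs"
proof (induction xs rule: length_induct)
  case (1 xs)
  show ?case
  proof (cases xs)
    case (Cons y ys)
    show ?thesis unfolding Cons list.map pf.simps altsum_map
      using 1 Cons by (intro altsum_cong) auto
  qed simp
qed

text \<open>The zero diagonal is a separate clause since it does not follow from antisymmetry in
  characteristic 2.\<close>

definition skew :: "('a \<Rightarrow> 'a \<Rightarrow> 'b::comm_ring_1) \<Rightarrow> bool" where
  "skew B \<longleftrightarrow> (\<forall>x y. B x y = - B y x) \<and> (\<forall>x. B x x = 0)"

lemma skew_flip: "skew B \<Longrightarrow> B x y = - B y x"
  unfolding skew_def by blast

lemma skew_diag [simp]: "skew B \<Longrightarrow> B x x = 0"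
  unfolding skew_def by blast

lemma pf_Cons_Cons:
  "pf B (x # y # xs) = B x y * pf B xs
     - altsum (\<lambda>z zs. altsum (\<lambda>w ws. B x z * B y w * pf B ws) zs) xs"
  by (simp add: pf.simps altsum_mult_left mult.assoc)

text \<open>A swap at the front is antisymmetry of the double sum in \<open>pf_Cons_Cons\<close>. A
  swap further back survives in the expansion along the first row, whose terms have shorter
  lists.\<close>

lemma pf_swap:
  fixes B :: "'a \<Rightarrow> 'a \<Rightarrow> 'b::comm_ring_1"
  assumes "skew B"
  shows "pf B (us @ x # y # vs) = - pf B (us @ y # x # vs)"
proof (induction "length us + length vs" arbitrary: us vs rule: less_induct)
  case less
  show ?case
  proof (cases us)
    case Nil
    have "altsum (\<lambda>z zs. altsum (\<lambda>w ws. B y z * B x w * pf B ws) zs) vs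
        = - altsum (\<lambda>z zs. altsum (\<lambda>w ws. B x z * B y w * pf B ws) zs) vs"
      using altsum_altsum_antisym[of "\<lambda>z w ws. B x z * B y w * pf B ws" vs]
      by (simp add: mult_ac)
    moreover have "B y x = - B x y"
      by (rule skew_flip[OF assms])
    ultimately show ?thesis
      by (simp add: Nil pf_Cons_Cons)
  next
    case (Cons u us')
    show ?thesis unfolding Cons append_Cons pf.simps
    proof (rule altsum_swap)
      fix z and ps qs :: "'a list"
      assume "length us' + length vs = Suc (length ps + length qs)"
      then show "B u z * pf B (ps @ x # y # qs) = - (B u z * pf B (ps @ y # x # qs))"
        using less[of ps qs] Cons by simp
    qed
  qed
qed

text \<open>Adjacent swaps bring the second copy of \<open>x\<close> next to the first. Then the
  diagonal entry is zero and the remaining double sum is symmetric, so it vanishes in every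
  characteristic.\<close>

lemma pf_repeated:
  assumes "skew B" and "x \<in> set xs"
  shows "pf B (x # xs) = 0"
proof -
  have "pf B (x # us @ x # vs) = 0" for us vs
  proof (induction us arbitrary: vs rule: rev_induct)
    case Nil
    have "altsum (\<lambda>z zs. altsum (\<lambda>w ws. B x z * B x w * pf B ws) zs) vs = 0"
      by (rule altsum_altsum_sym_eq_0) simp
    then show ?case
      using assms by (simp add: pf_Cons_Cons)
  next
    case (snoc u us)
    then show ?case
      using pf_swap[OF assms(1), of "x # us" u x vs] by simp
  qed
  then show ?thesis
    using assms(2) by (metis split_list)
qed

text \<open>Expanding the second factors, both sides become the same double sum (Dress and Wenzel).\<close>

lemma pf_exchange:
  assumes "skew B"
  shows "altsum (\<lambda>z zs. pf B zs * pf B (z # ys)) xs = - altsum (\<lambda>w ws. pf B ws * pf B (w # xs)) ys"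
proof -
  have flip: "pf B zs * (B z w * pf B ws) = - (pf B ws * (B w z * pf B zs))" for z zs w ws
    by (simp add: skew_flip[OF assms, of w z])
  have "altsum (\<lambda>z zs. pf B zs * pf B (z # ys)) xs
      = altsum (\<lambda>z zs. altsum (\<lambda>w ws. pf B zs * (B z w * pf B ws)) ys) xs"
    by (simp add: pf.simps altsum_mult_left)
  also have "\<dots> = altsum (\<lambda>w ws. altsum (\<lambda>z zs. pf B zs * (B z w * pf B ws)) xs) ys"
    by (rule altsum_exchange)
  also have "\<dots> = altsum (\<lambda>w ws. altsum (\<lambda>z zs. - (pf B ws * (B w z * pf B zs))) xs) ys"
    by (rule arg_cong[where f = "\<lambda>h. altsum (\<lambda>w ws. altsum (\<lambda>z zs. h z zs w ws) xs) ys"]) (intro ext flip)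
  also have "\<dots> = - altsum (\<lambda>w ws. pf B ws * pf B (w # xs)) ys"
    by (simp add: pf.simps altsum_mult_left altsum_minus)
  finally show ?thesis .
qed

text \<open>The exchange relation for the lists \<open>x # I\<close> and
  \<open>y # z # w # I\<close>. A term that selects an entry of \<open>I\<close> vanishes, as its
  second factor contains that entry twice; four terms remain.\<close>

lemma pf_plucker:
  assumes "skew B"
  shows "pf B I * pf B (x # y # z # w # I) =
     pf B (x # y # I) * pf B (z # w # I) - pf B (x # z # I) * pf B (y # w # I)
       + pf B (x # w # I) * pf B (y # z # I)"
proof -
  have left: "altsum (\<lambda>v vs. pf B (x # vs) * pf B (v # y # z # w # I)) I = 0"
    by (rule altsum_eq_0) (simp add: pf_repeated[OF assms])
  have right: "altsum (\<lambda>v vs. pf B (y # z # w # vs) * pf B (v # x # I)) I = 0"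
    by (rule altsum_eq_0) (simp add: pf_repeated[OF assms])
  have flip: "pf B (v # x # I) = - pf B (x # v # I)" for v
    using pf_swap[OF assms, of "[]" v x I] by simp
  have "pf B I * pf B (x # y # z # w # I) =
    - (pf B (z # w # I) * pf B (y # x # I)
       - (pf B (y # w # I) * pf B (z # x # I) - pf B (y # z # I) * pf B (w # x # I)))"
    using pf_exchange[OF assms, of "y # z # w # I" "x # I"] left right
    by (simp add: altsum_diff)
  then show ?thesis
    unfolding flip[of y] flip[of z] flip[of w] by (simp add: algebra_simps)
qed

section \<open>Expansion of the pfaffian along the first row\<close>

lemma permutes_permutation: "p permutes S \<Longrightarrow> finite S \<Longrightarrow> permutation p"
  unfolding permutation_permutes by blast

text \<open>The index set of the sum in \<open>pfaffian\<close>, named in order to be enumerated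
  recursively.\<close>

definition matching_perms :: "nat \<Rightarrow> (nat \<Rightarrow> nat) set" where
  "matching_perms r = {\<sigma>. \<sigma> permutes {1..2*r} \<and> (\<forall>i\<in>{1..r}. \<sigma> (2*i-1) < \<sigma> (2*i)) \<and>
     (\<forall>i\<in>{1..<r}. \<sigma> (2*i-1) < \<sigma> (2*i+1))}"

text \<open>The cycle sending \<open>2\<close> to \<open>j\<close>. The matching permutations with \<open>\<sigma> 2 = j\<close> are its composites with the
  shifted matching permutations of \<open>{3, \<dots>, 2r+2}\<close>.\<close>

definition second_to :: "nat \<Rightarrow> nat \<Rightarrow> nat" where
  "second_to j i = (if i = 2 then j else if 3 \<le> i \<and> i \<le> j then i - 1 else i)"

text \<open>Each increment of \<open>j\<close> composes with one adjacent transposition, starting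
  from the identity at \<open>j = 2\<close>.\<close>

lemma second_to:
  assumes "2 \<le> j"
  shows second_to_permutes: "second_to j permutes {2..j}"
    and sign_second_to: "sign (second_to j) = (- 1) ^ j"
proof -
  have "second_to j permutes {2..j} \<and> sign (second_to j) = (- 1) ^ j"
    using assms
  proof (induction j rule: dec_induct)
    case base
    have "second_to 2 = id" by (auto simp: second_to_def fun_eq_iff)
    then show ?case by (simp add: permutes_id id_def)
  next
    case (step j)
    have eq: "second_to (Suc j) = transpose j (Suc j) \<circ> second_to j"
      using step(1) by (auto simp: second_to_def fun_eq_iff transpose_def)
    have perm: "second_to j permutes {2..Suc j}" "transpose j (Suc j) permutes {2..Suc j}"
      using step by (auto intro: permutes_subset permutes_swap_id)
    have "permutation (second_to j)"
      by (rule permutes_permutation[OF perm(1)]) simp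
    then have "sign (second_to (Suc j)) = (- 1) ^ Suc j"
      unfolding eq by (subst sign_compose) (use step in \<open>auto simp: sign_swap_id permutation_swap_id\<close>)
    moreover have "second_to (Suc j) permutes {2..Suc j}"
      unfolding eq by (rule permutes_compose[OF perm])
    ultimately show ?case by blast
  qed
  then show "second_to j permutes {2..j}" "sign (second_to j) = (- 1) ^ j" by auto
qed

definition shift2 :: "nat \<Rightarrow> (nat \<Rightarrow> nat) \<Rightarrow> nat \<Rightarrow> nat" where
  "shift2 r \<tau> = map_permutation {1..2*r} (\<lambda>i. i + 2) \<tau>"

lemma bij_betw_add_2: "bij_betw (\<lambda>i. i + 2) {1..2*r} {3..2*r+(2::nat)}"
  by (rule bij_betw_byWitness[of _ "\<lambda>i. i - 2"]) auto

lemma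
  assumes "\<tau> permutes {1..2*r}"
  shows shift2_permutes: "shift2 r \<tau> permutes {3..2*r+2}"
    and sign_shift2: "sign (shift2 r \<tau>) = sign \<tau>"
  using assms map_permutation_permutes[OF bij_betw_add_2 assms]
  by (auto simp: shift2_def intro!: sign_map_permutation inj_onI)

lemma shift2_apply: "i \<in> {1..2*r} \<Longrightarrow> shift2 r \<tau> (Suc (Suc i)) = Suc (Suc (\<tau> i))"
  using map_permutation_apply[of "\<lambda>i. i + 2" "{1..2*r}" i \<tau>] unfolding shift2_def
  by (auto simp: inj_on_def)

text \<open>1 and 2 lie outside the image of the shift, where \<open>map_permutation\<close> is the
  identity.\<close>

lemma shift2_fixes:
  "shift2 r \<tau> (Suc 0) = Suc 0" "shift2 r \<tau> 2 = 2"
  by (auto simp: shift2_def map_permutation_def restrict_id_def)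

lemma shift2_surj:
  assumes "\<rho> permutes {3..2*r+2}"
  obtains \<tau> where "\<tau> permutes {1..2*r}" "\<rho> = shift2 r \<tau>"
proof
  let ?\<tau> = "map_permutation {3..2*r+2} (\<lambda>i. i - 2) \<rho>"
  have bij: "bij_betw (\<lambda>i. i - 2) {3..2*r+(2::nat)} {1..2*r}"
    by (rule bij_betw_byWitness[of _ "\<lambda>i. i + 2"]) auto
  show "?\<tau> permutes {1..2*r}"
    by (rule map_permutation_permutes[OF bij assms])
  show "\<rho> = shift2 r ?\<tau>"
    unfolding shift2_def
    by (rule map_permutation_compose_inv[symmetric, OF bij assms]) auto
qed

text \<open>The first members of the pairs increase and each is below its partner, so
  \<open>\<sigma> 1\<close> is the least value.\<close>

lemma matching_perm_1:
  assumes "\<sigma> \<in> matching_perms (Suc r)"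
  shows "\<sigma> 1 = 1"
proof -
  have perm: "\<sigma> permutes {1..2 * Suc r}" using assms by (simp add: matching_perms_def)
  have odd: "\<sigma> 1 \<le> \<sigma> (2 * i + 1)" if "i \<le> r" for i
    using that
  proof (induction i)
    case (Suc i)
    then have "\<sigma> (2 * Suc i - 1) < \<sigma> (2 * Suc i + 1)"
      using assms unfolding matching_perms_def mem_Collect_eq
      by (elim conjE ballE[of _ _ "Suc i"]) auto
    with Suc show ?case by simp
  qed simp
  have all: "\<sigma> 1 \<le> \<sigma> m" if m: "m \<in> {1..2 * Suc r}" for m
  proof (cases "even m")
    case True
    then obtain i where i: "m = 2 * i" by auto
    then have "\<sigma> (2 * i - 1) < \<sigma> (2 * i)"
      using assms m unfolding matching_perms_def by auto
    moreover have "2 * i - 1 = 2 * (i - 1) + 1" using i m by auto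
    moreover have "i - 1 \<le> r" using i m by auto
    ultimately show ?thesis using odd[of "i - 1"] i by simp
  next
    case False
    then obtain i where "m = 2 * i + 1" by (auto elim: oddE)
    then show ?thesis using odd[of i] m by auto
  qed
  have "1 \<in> \<sigma> ` {1..2 * Suc r}" using permutes_image[OF perm] by auto
  then obtain m where "m \<in> {1..2 * Suc r}" "\<sigma> m = 1" by auto
  then have "\<sigma> 1 \<le> 1" using all by force
  moreover have "\<sigma> 1 \<in> {1..2 * Suc r}" using permutes_in_image[OF perm, of 1] by auto
  ultimately show ?thesis by auto
qed

text \<open>The matching that pairs 1 with \<open>j\<close> and copies \<open>\<tau>\<close> onto
  the other labels in increasing order.\<close>

definition extend_matching :: "nat \<Rightarrow> nat \<Rightarrow> (nat \<Rightarrow> nat) \<Rightarrow> nat \<Rightarrow> nat" where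
  "extend_matching r j \<tau> = second_to j \<circ> shift2 r \<tau>"

lemma extend_matching_simps:
  assumes "2 \<le> j"
  shows "extend_matching r j \<tau> (Suc 0) = 1" "extend_matching r j \<tau> 2 = j"
    "i \<in> {1..2*r} \<Longrightarrow> extend_matching r j \<tau> (Suc (Suc i)) = second_to j (Suc (Suc (\<tau> i)))"
  using assms by (simp_all add: extend_matching_def shift2_fixes shift2_apply second_to_def)

lemma second_to_mono_iff: "3 \<le> i \<Longrightarrow> 3 \<le> l \<Longrightarrow> second_to j i < second_to j l \<longleftrightarrow> i < l"
  by (auto simp: second_to_def)

lemma Ball_atLeastAtMost_Suc: "(\<forall>i\<in>{1..Suc r}. Q i) \<longleftrightarrow> Q 1 \<and> (\<forall>i\<in>{1..r}. Q (Suc i))"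
  by (auto simp: Ball_def) (metis Suc_le_mono not0_implies_Suc not_less_eq_eq le_zero_eq)

text \<open>Conditions on the new pair hold because its first member is 1. The others carry over to
  \<open>\<tau>\<close>, since \<open>second_to j\<close> is increasing from 3 on.\<close>

lemma extend_matching_in_iff:
  assumes "j \<in> {2..2*r+2}" and \<tau>: "\<tau> permutes {1..2*r}"
  shows "extend_matching r j \<tau> \<in> matching_perms (Suc r) \<longleftrightarrow> \<tau> \<in> matching_perms r"
proof -
  let ?\<sigma> = "extend_matching r j \<tau>"
  have "second_to j permutes {1..2*Suc r}"
    by (rule permutes_subset[OF second_to_permutes]) (use assms in auto)
  moreover have "shift2 r \<tau> permutes {1..2*Suc r}"
    by (rule permutes_subset[OF shift2_permutes[OF \<tau>]]) auto
  ultimately have perm: "?\<sigma> permutes {1..2*Suc r}"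
    unfolding extend_matching_def by (rule permutes_compose[rotated])
  have pos: "\<tau> i \<ge> 1" if "i \<in> {1..2*r}" for i
    using permutes_in_image[OF \<tau>, of i] that by auto
  have less_iff: "?\<sigma> (Suc (Suc i)) < ?\<sigma> (Suc (Suc l)) \<longleftrightarrow> \<tau> i < \<tau> l" if "i \<in> {1..2*r}" "l \<in> {1..2*r}" for i l
    using that assms pos[of i] pos[of l]
    by (simp add: extend_matching_simps second_to_mono_iff)
  have "(\<forall>i\<in>{1..Suc r}. ?\<sigma> (2*i-1) < ?\<sigma> (2*i)) \<longleftrightarrow> (\<forall>i\<in>{1..r}. \<tau> (2*i-1) < \<tau> (2*i))"
  proof -
    have "?\<sigma> (2 * Suc i - 1) < ?\<sigma> (2 * Suc i) \<longleftrightarrow> \<tau> (2*i-1) < \<tau> (2*i)" if "i \<in> {1..r}" for i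
    proof -
      have i: "2 * Suc i - 1 = Suc (Suc (2*i-1))" "2 * Suc i = Suc (Suc (2*i))"
        "2*i-1 \<in> {1..2*r}" "2*i \<in> {1..2*r}"
        using that by auto
      show ?thesis unfolding i(1) unfolding i(2) by (rule less_iff[OF i(3,4)])
    qed
    then show ?thesis
      unfolding Ball_atLeastAtMost_Suc using assms by (auto simp: extend_matching_simps)
  qed
  moreover have "(\<forall>i\<in>{1..<Suc r}. ?\<sigma> (2*i-1) < ?\<sigma> (2*i+1)) \<longleftrightarrow> (\<forall>i\<in>{1..<r}. \<tau> (2*i-1) < \<tau> (2*i+1))"
  proof (cases r)
    case (Suc s)
    have "?\<sigma> (2 * Suc i - 1) < ?\<sigma> (2 * Suc i + 1) \<longleftrightarrow> \<tau> (2*i-1) < \<tau> (2*i+1)" if "i \<in> {1..s}" for i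
    proof -
      have i: "2 * Suc i - 1 = Suc (Suc (2*i-1))" "2 * Suc i + 1 = Suc (Suc (2*i+1))"
        "2*i-1 \<in> {1..2*r}" "2*i+1 \<in> {1..2*r}"
        using that Suc by auto
      show ?thesis unfolding i(1) unfolding i(2) by (rule less_iff[OF i(3,4)])
    qed
    moreover have "?\<sigma> (2 * 1 - 1) < ?\<sigma> (2 * 1 + 1)"
    proof -
      have j: "2 \<le> j" and 1: "1 \<in> {1..2*r}" using assms Suc by auto
      have "1 < second_to j (Suc (Suc (\<tau> 1)))"
        using pos[OF 1] j by (auto simp: second_to_def)
      moreover have "2 * 1 - 1 = Suc 0" "2 * 1 + 1 = Suc (Suc 1)" by simp_all
      ultimately show ?thesis
        by (simp only: extend_matching_simps(1)[OF j] extend_matching_simps(3)[OF j 1])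
    qed
    ultimately show ?thesis
      unfolding Suc atLeastLessThanSuc_atLeastAtMost Ball_atLeastAtMost_Suc by auto
  qed simp
  ultimately show ?thesis
    using perm \<tau> by (simp add: matching_perms_def)
qed

text \<open>The value at 2 recovers \<open>j\<close>; injectivity of \<open>second_to j\<close> then
  recovers \<open>\<tau>\<close>.\<close>

lemma inj_on_extend_matching:
  "inj_on (\<lambda>(j, \<tau>). extend_matching r j \<tau>) ({2..2*r+2} \<times> {\<tau>. \<tau> permutes {1..2*r}})"
proof (rule inj_onI, clarify)
  fix j \<tau> j' \<tau>'
  assume j: "j \<in> {2..2*r+2}" "j' \<in> {2..2*r+2}" and \<tau>: "\<tau> permutes {1..2*r}" "\<tau>' permutes {1..2*r}"
    and eq: "extend_matching r j \<tau> = extend_matching r j' \<tau>'"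
  have jj: "j = j'"
    using fun_cong[OF eq, of 2] j by (simp add: extend_matching_simps)
  have inj: "inj (second_to j)"
    using second_to_permutes[of j] j by (auto intro: permutes_inj)
  have "\<tau> i = \<tau>' i" for i
  proof (cases "i \<in> {1..2*r}")
    case True
    then have "second_to j (Suc (Suc (\<tau> i))) = second_to j (Suc (Suc (\<tau>' i)))"
      using fun_cong[OF eq, of "Suc (Suc i)"] j jj by (simp add: extend_matching_simps)
    then show ?thesis using injD[OF inj] by blast
  next
    case False
    then show ?thesis using \<tau> by (simp add: permutes_not_in)
  qed
  with jj show "j = j' \<and> \<tau> = \<tau>'" by auto
qed

text \<open>Undoing the cycle \<open>second_to (\<sigma> 2)\<close> leaves a permutation that fixes
  1 and 2, hence a shifted permutation of \<open>{1..2*r}\<close>.\<close>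

lemma matching_perms_Suc:
  "matching_perms (Suc r) = (\<lambda>(j, \<tau>). extend_matching r j \<tau>) ` ({2..2*r+2} \<times> matching_perms r)"
proof (intro equalityI subsetI)
  fix \<sigma> assume \<sigma>: "\<sigma> \<in> matching_perms (Suc r)"
  define j where "j = \<sigma> 2"
  have perm: "\<sigma> permutes {1..2*Suc r}" using \<sigma> by (simp add: matching_perms_def)
  have \<sigma>1: "\<sigma> 1 = 1" by (rule matching_perm_1[OF \<sigma>])
  have "j \<noteq> 1" using injD[OF permutes_inj[OF perm], of 2 1] \<sigma>1 unfolding j_def by auto
  moreover have "j \<in> {1..2*Suc r}" using permutes_in_image[OF perm, of 2] unfolding j_def by auto
  ultimately have j: "j \<in> {2..2*r+2}" by auto
  have perm_j: "second_to j permutes {1..2*Suc r}"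
    by (rule permutes_subset[OF second_to_permutes]) (use j in auto)
  define \<rho> where "\<rho> = inv_into UNIV (second_to j) \<circ> \<sigma>"
  have \<rho>: "\<rho> permutes {1..2*Suc r}"
    unfolding \<rho>_def by (rule permutes_compose[OF perm permutes_inv[OF perm_j]])
  have \<rho>1: "\<rho> 1 = 1"
    using \<sigma>1 permutes_inv_eq[OF perm_j, of 1 1] by (simp add: \<rho>_def second_to_def)
  have \<rho>2: "\<rho> 2 = 2"
    using permutes_inv_eq[OF perm_j, of j 2] by (simp add: \<rho>_def second_to_def j_def)
  have "\<rho> permutes {3..2*r+2}"
  proof (rule permutes_superset[OF \<rho>])
    show "\<rho> x = x" if x: "x \<in> {1..2*Suc r} - {3..2*r+2}" for x
    proof -
      from x have "x = 1 \<or> x = 2" by auto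
      then show "\<rho> x = x" using \<rho>1 \<rho>2 by auto
    qed
  qed
  then obtain \<tau> where \<tau>: "\<tau> permutes {1..2*r}" "\<rho> = shift2 r \<tau>"
    by (rule shift2_surj)
  have "\<sigma> = second_to j \<circ> \<rho>"
    unfolding \<rho>_def using permutes_inv_o(1)[OF perm_j] by (simp add: o_assoc)
  then have eq: "\<sigma> = extend_matching r j \<tau>"
    by (simp only: extend_matching_def \<tau>(2))
  have "\<tau> \<in> matching_perms r"
    using \<sigma> unfolding eq extend_matching_in_iff[OF j \<tau>(1)] .
  with eq show "\<sigma> \<in> (\<lambda>(j, \<tau>). extend_matching r j \<tau>) ` ({2..2*r+2} \<times> matching_perms r)"
    using j by (intro image_eqI[of _ _ "(j, \<tau>)"]) simp_all
next
  fix \<sigma> assume "\<sigma> \<in> (\<lambda>(j, \<tau>). extend_matching r j \<tau>) ` ({2..2*r+2} \<times> matching_perms r)"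
  then obtain j \<tau> where "j \<in> {2..2*r+2}" "\<tau> \<in> matching_perms r" "\<sigma> = extend_matching r j \<tau>"
    by (elim imageE SigmaE) simp
  then show "\<sigma> \<in> matching_perms (Suc r)"
    using extend_matching_in_iff[of j r \<tau>] by (simp add: matching_perms_def[of r])
qed

lemma sign_extend_matching:
  assumes "2 \<le> j" and "\<tau> permutes {1..2*r}"
  shows "sign (extend_matching r j \<tau>) = (- 1) ^ j * sign \<tau>"
proof -
  have "permutation (second_to j)" "permutation (shift2 r \<tau>)"
    using permutes_permutation[OF second_to_permutes[OF assms(1)]]
      permutes_permutation[OF shift2_permutes[OF assms(2)]] by simp_all
  then show ?thesis
    by (simp add: extend_matching_def sign_compose sign_second_to sign_shift2[OF assms(2)] assms(1))
qed

lemma prod_1_Suc: "(\<Prod>i=1..Suc r. f i) = f 1 * (\<Prod>i=1..r. f (Suc i))"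
  by (induction r) (simp_all add: mult.assoc)

text \<open>Reindexing by the pairs \<open>(j, \<tau>)\<close>: the factor of the first pair is
  \<open>B 1 j\<close>, and the cycle contributes the sign \<open>(- 1) ^ j\<close>.\<close>

lemma pfaffian_Suc:
  "pfaffian (Suc r) B = (\<Sum>j=2..2*r+2. (- 1) ^ j * B 1 j *
     pfaffian r (\<lambda>i l. B (second_to j (i + 2)) (second_to j (l + 2))))"
proof -
  let ?t = "\<lambda>\<sigma>. of_int (sign \<sigma>) * (\<Prod>i=1..Suc r. B (\<sigma> (2*i-1)) (\<sigma> (2*i)))"
  let ?u = "\<lambda>j \<tau>. of_int (sign \<tau>) *
    (\<Prod>i=1..r. B (second_to j (\<tau> (2*i-1) + 2)) (second_to j (\<tau> (2*i) + 2)))"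
  have t: "?t (extend_matching r j \<tau>) = (- 1) ^ j * B 1 j * ?u j \<tau>"
    if "j \<in> {2..2*r+2}" "\<tau> \<in> matching_perms r" for j \<tau>
  proof -
    have \<tau>: "\<tau> permutes {1..2*r}" using that by (simp add: matching_perms_def)
    have e: "extend_matching r j \<tau> (2 * Suc i - 1) = second_to j (\<tau> (2*i-1) + 2)"
      "extend_matching r j \<tau> (2 * Suc i) = second_to j (\<tau> (2*i) + 2)" if "i \<in> {1..r}" for i
    proof -
      have i: "2 * Suc i - 1 = Suc (Suc (2*i-1))" "2 * Suc i = Suc (Suc (2*i))"
        "2*i-1 \<in> {1..2*r}" "2*i \<in> {1..2*r}" "2 \<le> j"
        using that \<open>j \<in> _\<close> by auto
      show "extend_matching r j \<tau> (2 * Suc i - 1) = second_to j (\<tau> (2*i-1) + 2)"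
        unfolding i(1) extend_matching_simps(3)[OF i(5) i(3)] by simp
      show "extend_matching r j \<tau> (2 * Suc i) = second_to j (\<tau> (2*i) + 2)"
        unfolding i(2) extend_matching_simps(3)[OF i(5) i(4)] by simp
    qed
    have "(\<Prod>i=1..r. B (extend_matching r j \<tau> (2*Suc i-1)) (extend_matching r j \<tau> (2*Suc i)))
      = (\<Prod>i=1..r. B (second_to j (\<tau> (2*i-1) + 2)) (second_to j (\<tau> (2*i) + 2)))"
      by (intro prod.cong refl) (simp only: e)
    moreover have "(\<Prod>i=1..Suc r. B (extend_matching r j \<tau> (2*i-1)) (extend_matching r j \<tau> (2*i))) =
      B 1 j * (\<Prod>i=1..r. B (extend_matching r j \<tau> (2*Suc i-1)) (extend_matching r j \<tau> (2*Suc i)))"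
    proof -
      have "2 \<le> j" using that by simp
      then show ?thesis
        unfolding prod_1_Suc by (simp only: mult_1_right diff_Suc_1 one_le_numeral extend_matching_simps) (simp add: extend_matching_simps)
    qed
    moreover have "sign (extend_matching r j \<tau>) = (- 1) ^ j * sign \<tau>"
      using that by (intro sign_extend_matching \<tau>) auto
    ultimately show ?thesis by (simp only: of_int_mult of_int_power of_int_minus of_int_1 mult_ac)
  qed
  have "pfaffian (Suc r) B = (\<Sum>\<sigma>\<in>matching_perms (Suc r). ?t \<sigma>)"
    by (simp only: pfaffian_def matching_perms_def)
  also have "\<dots> = (\<Sum>(j, \<tau>)\<in>{2..2*r+2} \<times> matching_perms r. ?t (extend_matching r j \<tau>))"
  proof -
    have "{2..2*r+2} \<times> matching_perms r \<subseteq> {2..2*r+2} \<times> {\<tau>. \<tau> permutes {1..2*r}}"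
      by (auto simp: matching_perms_def)
    from inj_on_subset[OF inj_on_extend_matching this]
    show ?thesis
      unfolding matching_perms_Suc by (simp only: sum.reindex o_def case_prod_unfold)
  qed
  also have "\<dots> = (\<Sum>j=2..2*r+2. \<Sum>\<tau>\<in>matching_perms r. ?t (extend_matching r j \<tau>))"
    by (simp add: sum.cartesian_product)
  also have "\<dots> = (\<Sum>j=2..2*r+2. \<Sum>\<tau>\<in>matching_perms r. (- 1) ^ j * B 1 j * ?u j \<tau>)"
    by (intro sum.cong refl t)
  also have "\<dots> = (\<Sum>j=2..2*r+2. (- 1) ^ j * B 1 j *
      pfaffian r (\<lambda>i l. B (second_to j (i + 2)) (second_to j (l + 2))))"
    by (simp add: sum_distrib_left pfaffian_def matching_perms_def)
  finally show ?thesis .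
qed

section \<open>Agreement of the matching sum with the recursive pfaffian\<close>

lemma pfaffian_0: "pfaffian 0 B = 1"
proof -
  have "{\<sigma>. \<sigma> permutes {1..2*0::nat} \<and> (\<forall>i\<in>{1..0::nat}. \<sigma> (2*i-1) < \<sigma> (2*i)) \<and>
     (\<forall>i\<in>{1..<0}. \<sigma> (2*i-1) < \<sigma> (2*i+1))} = {id}"
    by auto
  then show ?thesis
    unfolding pfaffian_def by simp
qed

lemma altsum_conv_sum:
  "altsum f xs = (\<Sum>i<length xs. (- 1) ^ i * f (xs ! i) (take i xs @ drop (Suc i) xs))"
  by (induction xs arbitrary: f)
    (simp_all add: sum.lessThan_Suc_shift sum_negf del: sum.lessThan_Suc)

text \<open>Both sides have the same first-row expansion. The induction is over all \<open>B\<close>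
  since the smaller pfaffians belong to relabelled matrices; \<open>pf_map\<close> moves the
  relabelling into the list.\<close>

lemma pfaffian_eq_pf: "pfaffian r B = pf B [1..<2*r+1]"
proof (induction r arbitrary: B)
  case 0
  show ?case by (simp add: pfaffian_0)
next
  case (Suc r)
  let ?L = "[2..<2*r+3]"
  have "pfaffian (Suc r) B = (\<Sum>j=2..2*r+2. (- 1) ^ j * B 1 j *
     pf B (map (\<lambda>i. second_to j (i + 2)) [1..<2*r+1]))"
    unfolding pfaffian_Suc Suc.IH pf_map ..
  also have "\<dots> = (\<Sum>i<2*r+1. (- 1) ^ (i + 2) * B 1 (i + 2) *
     pf B (map (\<lambda>l. second_to (i + 2) (l + 2)) [1..<2*r+1]))"
    by (rule sym, rule sum.reindex_bij_witness[of _ "\<lambda>i. i - 2" "\<lambda>i. i + 2"]) (auto simp del: upt_Suc)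
  also have "\<dots> = (\<Sum>i<length ?L. (- 1) ^ i * (B 1 (?L ! i) * pf B (take i ?L @ drop (Suc i) ?L)))"
  proof (rule sum.cong)
    fix i assume "i \<in> {..<length ?L}"
    then have i: "i < 2*r+1" by simp
    \<comment> \<open>Position \<open>i\<close> of \<open>?L\<close> holds the label
      \<open>i + 2\<close>, and \<open>second_to (i + 2)\<close> enumerates the labels left after
      its deletion.\<close>
    have "map (\<lambda>l. second_to (i + 2) (l + 2)) [1..<2*r+1] = take i ?L @ drop (Suc i) ?L"
      using i by (intro nth_equalityI) (simp_all add: nth_append second_to_def del: upt_Suc)
    then show "(- 1) ^ (i + 2) * B 1 (i + 2) * pf B (map (\<lambda>l. second_to (i + 2) (l + 2)) [1..<2*r+1]) =
      (- 1) ^ i * (B 1 (?L ! i) * pf B (take i ?L @ drop (Suc i) ?L))"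
      using i by (simp only: nth_upt length_upt) (simp add: add.commute[of i 2] mult.assoc del: upt_Suc)
  qed simp
  also have "\<dots> = pf B (1 # ?L)"
    unfolding pf.simps altsum_conv_sum ..
  also have "1 # ?L = [1..<2*Suc r+1]"
  proof -
    have "[1..<2*Suc r+1] = [1..<2*r+3]" by (rule arg_cong[where f = "upt 1"]) simp
    also have "\<dots> = 1 # [Suc 1..<2*r+3]" by (rule upt_conv_Cons) simp
    finally show ?thesis by (simp only: Suc_1)
  qed
  finally show ?case .
qed

section \<open>Evaluation of jets\<close>

definition eval_coeffs :: "('v \<Rightarrow> 'a) \<Rightarrow> ('v, 'a::comm_ring_1) mpol poly \<Rightarrow> 'a poly" where
  "eval_coeffs x = map_poly (pol_value x)"

lemma coeff_eval_coeffs [simp]: "coeff (eval_coeffs x p) h = pol_value x (coeff p h)"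
  by (simp add: eval_coeffs_def coeff_map_poly)

lemma pol_value_sum: "pol_value x (sum f A) = (\<Sum>i\<in>A. pol_value x (f i))"
  by (induction A rule: infinite_finite_induct) (simp_all add: pol_value_add)

lemma pol_value_minus: "pol_value x (- p) = - pol_value x p"
  using pol_value_add[of x p "- p"] by (simp add: eq_neg_iff_add_eq_0 add.commute)

lemma pol_value_diff: "pol_value x (p - q) = pol_value x p - pol_value x q"
  using pol_value_add[of x p "- q"] by (simp add: pol_value_minus)

lemma eval_coeffs_simps:
  "eval_coeffs x 0 = 0" "eval_coeffs x 1 = 1" "eval_coeffs x (- p) = - eval_coeffs x p"
  "eval_coeffs x (p - q) = eval_coeffs x p - eval_coeffs x q"
  "eval_coeffs x (p * q) = eval_coeffs x p * eval_coeffs x q"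
  by (auto simp: poly_eq_iff coeff_mult pol_value_sum pol_value_mult pol_value_minus pol_value_diff)

lemma pf_hom:
  fixes B :: "'a \<Rightarrow> 'a \<Rightarrow> 'b::comm_ring_1" and \<phi> :: "'b \<Rightarrow> 'c::comm_ring_1"
  assumes "\<phi> 1 = 1" "\<And>p q. \<phi> (p - q) = \<phi> p - \<phi> q" "\<And>p q. \<phi> (p * q) = \<phi> p * \<phi> q"
  shows "\<phi> (pf B xs) = pf (\<lambda>i j. \<phi> (B i j)) xs"
proof (induction xs rule: length_induct)
  case (1 xs)
  have alt: "\<phi> (altsum f ys) = altsum (\<lambda>z zs. \<phi> (f z zs)) ys" for f and ys :: "'a list"
    \<comment> \<open>This instance yields \<open>\<phi> 0 = 0\<close>, the case of the empty
      list.\<close>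
    using assms(2)[of 0 0] by (induction ys arbitrary: f) (simp_all add: assms(2))
  show ?case
  proof (cases xs)
    case (Cons y ys)
    show ?thesis unfolding Cons pf.simps alt
      using 1 Cons by (intro altsum_cong) (auto simp: assms(3))
  qed (simp add: assms(1))
qed

lemma eval_coeffs_pf: "eval_coeffs x (pf B xs) = pf (\<lambda>i j. eval_coeffs x (B i j)) xs"
  by (rule pf_hom) (simp_all add: eval_coeffs_simps)

lemma pol_carrier_minus: "p \<in> pol_carrier V \<Longrightarrow> q \<in> pol_carrier V \<Longrightarrow> p - q \<in> pol_carrier V"
  using pol_carrier_closed(4)[of p V "- q"] pol_carrier_closed(3)[of q V] by simp

lemma pol_carrier_sum: "(\<And>i. i \<in> A \<Longrightarrow> f i \<in> pol_carrier V) \<Longrightarrow> sum f A \<in> pol_carrier V"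
  by (induction A rule: infinite_finite_induct) (auto intro: pol_carrier_closed)

text \<open>Membership in \<open>K[V][t]\<close>. The type has more variables than \<open>V\<close>,
  whereas ideal generators and equations of closed sets must lie in
  \<open>pol_carrier V\<close>.\<close>

definition coeffs_in :: "'v set \<Rightarrow> ('v, 'a::comm_ring_1) mpol poly \<Rightarrow> bool" where
  "coeffs_in V p \<longleftrightarrow> (\<forall>h. coeff p h \<in> pol_carrier V)"

lemma coeffs_in_closed:
  "coeffs_in V 0" "coeffs_in V 1"
  "coeffs_in V p \<Longrightarrow> coeffs_in V (- p)"
  "coeffs_in V p \<Longrightarrow> coeffs_in V q \<Longrightarrow> coeffs_in V (p - q)"
  "coeffs_in V p \<Longrightarrow> coeffs_in V q \<Longrightarrow> coeffs_in V (p * q)"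
  by (auto simp: coeffs_in_def coeff_mult lead_coeff_1 coeff_1
      intro!: pol_carrier_closed pol_carrier_minus pol_carrier_sum split: if_splits)

lemma coeffs_in_pf:
  fixes B :: "'i \<Rightarrow> 'i \<Rightarrow> ('v, 'a::comm_ring_1) mpol poly"
  assumes "\<And>i j. i \<in> set xs \<Longrightarrow> j \<in> set xs \<Longrightarrow> coeffs_in V (B i j)"
  shows "coeffs_in V (pf B xs)"
  using assms
proof (induction xs rule: length_induct)
  case (1 xs)
  have alt: "coeffs_in V (altsum f ys)"
    if "\<And>z zs. z \<in> set ys \<Longrightarrow> set zs \<subseteq> set ys \<Longrightarrow> length ys = Suc (length zs) \<Longrightarrow> coeffs_in V (f z zs)"
    for f :: "'i \<Rightarrow> 'i list \<Rightarrow> ('v, 'a) mpol poly" and ys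
    using that
  proof (induction ys arbitrary: f)
    case (Cons y ys)
    have "coeffs_in V (altsum (\<lambda>z zs. f z (y # zs)) ys)"
      by (intro Cons.IH Cons.prems) auto
    moreover have "coeffs_in V (f y ys)" by (intro Cons.prems) auto
    ultimately show ?case by (simp add: coeffs_in_closed)
  qed (simp add: coeffs_in_closed)
  show ?case
  proof (cases xs)
    case (Cons y ys)
    show ?thesis unfolding Cons pf.simps
    proof (intro alt coeffs_in_closed)
      fix z zs assume *: "z \<in> set ys" "set zs \<subseteq> set ys" "length ys = Suc (length zs)"
      show "coeffs_in V (B y z)" using * Cons by (intro 1) auto
      show "coeffs_in V (pf B zs)" using * Cons 1 by (auto simp: subset_iff)
    qed
  qed (simp add: coeffs_in_closed)
qed

text \<open>The polynomials that vanish at a fixed point form an ideal, which contains the generated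
  ideal once it contains \<open>S\<close>.\<close>

lemma zero_locus_genideal:
  fixes S :: "('v, 'a::comm_ring_1) mpol set"
  assumes "S \<subseteq> pol_carrier V"
  shows "zero_locus V (Idl\<^bsub>pol_ring V\<^esub> S) = zero_locus V S"
proof -
  let ?R = "pol_ring V :: ('v, 'a) mpol ring"
  interpret cring ?R by (rule cring_pol_ring)
  have carr: "carrier ?R = (pol_carrier V :: ('v, 'a) mpol set)" by (simp add: pol_ring_def)
  have "S \<subseteq> Idl\<^bsub>?R\<^esub> S"
    using genideal_self[of S] assms carr by simp
  moreover have "pol_value x p = 0"
    if x: "\<forall>q\<in>S. pol_value x q = 0" and p: "p \<in> Idl\<^bsub>?R\<^esub> S" for x and p :: "('v, 'a) mpol"
  proof -
    let ?J = "{q \<in> pol_carrier V. pol_value x q = 0}"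
    have inv: "\<ominus>\<^bsub>?R\<^esub> q = - q" if "q \<in> pol_carrier V" for q :: "('v, 'a) mpol"
      using that by (intro minus_equality) (auto simp: pol_ring_def pol_carrier_closed)
    have "ideal ?J ?R"
    proof (rule idealI)
      show "ring ?R" by (rule ring_axioms)
      show "subgroup ?J (add_monoid ?R)"
      proof (rule add.subgroupI)
        show "?J \<noteq> {}" using pol_carrier_closed(1)[of V] pol_value_0[of x] by blast
        show "\<ominus>\<^bsub>?R\<^esub> q \<in> ?J" if "q \<in> ?J" for q
          using that inv[of q] by (simp add: pol_value_minus pol_carrier_closed)
      qed (auto simp: pol_ring_def pol_value_add pol_carrier_closed)
    qed (auto simp: pol_ring_def pol_value_mult pol_carrier_closed)
    then have "Idl\<^bsub>?R\<^esub> S \<subseteq> ?J"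
      using x assms by (intro genideal_minimal) auto
    then show ?thesis using p by auto
  qed
  ultimately show ?thesis unfolding zero_locus_def by blast
qed

text \<open>Orders in \<open>t\<close> add over a domain: \<open>f\<close> has some order
  \<open>m < d\<close>, so \<open>g\<close> has order at least \<open>N - m\<close>, which exceeds
  \<open>N - d\<close>.\<close>

lemma coeff_zero_of_monom_dvd_mult:
  fixes f g :: "'a::idom poly"
  assumes dvd: "monom 1 N dvd f * g" and e: "coeff f e \<noteq> 0" "e < d" and "d \<le> N"
  shows "coeff g (N - d) = 0"
proof -
  define m where "m = (LEAST i. coeff f i \<noteq> 0)"
  have m: "coeff f m \<noteq> 0" "m < d"
    using e LeastI[of "\<lambda>i. coeff f i \<noteq> 0" e] Least_le[of "\<lambda>i. coeff f i \<noteq> 0" e]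
    unfolding m_def by auto
  have below: "coeff f i = 0" if "i < m" for i
    using not_less_Least[OF that[unfolded m_def]] by simp
  have "coeff g j = 0" if "j < N - m" for j
    using that
  proof (induction j rule: less_induct)
    case (less j)
    \<comment> \<open>Only \<open>i = m\<close> contributes: below \<open>m\<close> the coefficient
      of \<open>f\<close> is zero, and above it the index for \<open>g\<close> drops below
      \<open>j\<close>.\<close>
    have "(\<Sum>i\<le>m + j. coeff f i * coeff g (m + j - i)) = (\<Sum>i\<in>{m}. coeff f i * coeff g (m + j - i))"
    proof (rule sum.mono_neutral_right)
      show "\<forall>i\<in>{..m + j} - {m}. coeff f i * coeff g (m + j - i) = 0"
      proof
        fix i assume "i \<in> {..m + j} - {m}"
        then consider "i < m" | "m < i" "i \<le> m + j" by force
        then show "coeff f i * coeff g (m + j - i) = 0"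
          using below[of i] less by cases auto
      qed
    qed auto
    then have "coeff (f * g) (m + j) = coeff f m * coeff g j"
      by (simp add: coeff_mult)
    moreover have "coeff (f * g) (m + j) = 0"
      using dvd less.prems by (simp add: monom_1_dvd_iff')
    ultimately show ?case using m by simp
  qed
  then show ?thesis using m(2) \<open>d \<le> N\<close> by simp
qed

text \<open>In \<open>pf_Cons_Cons\<close> every term of the double sum contains an entry of the
  first row outside its block, so only the product with the first block entry remains.\<close>

lemma pf_upt_block_diagonal:
  assumes "\<And>i z. i < m \<Longrightarrow> s + 2 * i + 1 < z \<Longrightarrow> z < s + 2 * m \<Longrightarrow> B (s + 2 * i) z = 0"
  shows "pf B [s..<s + 2 * m] = (\<Prod>i<m. B (s + 2 * i) (s + 2 * i + 1))"
  using assms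
proof (induction m arbitrary: s)
  case (Suc m)
  have eq: "[s..<s + 2 * Suc m] = s # Suc s # [s + 2..<(s + 2) + 2 * m]"
    by (simp add: upt_conv_Cons del: upt_Suc)
  have "altsum (\<lambda>z zs. altsum (\<lambda>w ws. B s z * B (Suc s) w * pf B ws) zs) [s + 2..<(s + 2) + 2 * m] = 0"
  proof (rule altsum_eq_0)
    fix z zs assume "z \<in> set [s + 2..<(s + 2) + 2 * m]"
    then have "s + 2 \<le> z" "z < s + 2 * Suc m" by (simp_all del: upt_Suc)
    then have "B s z = 0" using Suc.prems[of 0 z] by simp
    then show "altsum (\<lambda>w ws. B s z * B (Suc s) w * pf B ws) zs = 0" by simp
  qed
  then have "pf B [s..<s + 2 * Suc m] = B s (Suc s) * pf B [s + 2..<(s + 2) + 2 * m]"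
    unfolding eq by (simp add: pf_Cons_Cons)
  also have "pf B [s + 2..<(s + 2) + 2 * m] = (\<Prod>i<m. B (s + 2 + 2 * i) (s + 2 + 2 * i + 1))"
  proof (rule Suc.IH)
    show "B (s + 2 + 2 * i) z = 0" if "i < m" "s + 2 + 2 * i + 1 < z" "z < s + 2 + 2 * m" for i z
      using Suc.prems[of "Suc i" z] that by simp
  qed
  finally show ?case by (simp add: prod.lessThan_Suc_shift del: prod.lessThan_Suc)
qed simp

section \<open>The jet matrix at a point and the equations of the variety\<close>

definition jet_value :: "nat \<Rightarrow> (nat \<times> nat \<times> nat \<Rightarrow> 'a::comm_ring_1) \<Rightarrow> nat \<Rightarrow> nat \<Rightarrow> 'a poly" where
  "jet_value k x i j = eval_coeffs x (jet_matrix k i j)"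

lemma skew_jet_value: "skew (jet_value k x)"
  unfolding skew_def jet_value_def jet_matrix_def by (auto simp: eval_coeffs_simps)

lemma coeff_jet_value:
  fixes x :: "nat \<times> nat \<times> nat \<Rightarrow> 'a::comm_ring_1"
  assumes "i < j"
  shows "coeff (jet_value k x i j) h = (if h < k then x (i, j, h) else 0)"
proof -
  have "coeff (jet_entry k i j :: (nat \<times> nat \<times> nat, 'a) mpol poly) h = (if h < k then pvar (i, j, h) else 0)"
    by (simp add: jet_entry_def coeff_sum if_distrib[of "\<lambda>f. f _"] sum.If_cases cong: if_cong)
  with assms show ?thesis
    by (simp add: jet_value_def jet_matrix_def)
qed

lemma pf_jet_value: "pf (jet_value k x) L = eval_coeffs x (pf (jet_matrix k) L)"
  unfolding eval_coeffs_pf jet_value_def[abs_def] ..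

lemma coeffs_in_jet_matrix:
  assumes "i \<in> {1..n}" "j \<in> {1..n}"
  shows "coeffs_in (jet_vars n k) (jet_matrix k i j)"
proof -
  have "coeffs_in (jet_vars n k) (jet_entry k i j)" if "i < j" "i \<in> {1..n}" "j \<in> {1..n}" for i j
    unfolding coeffs_in_def jet_entry_def coeff_sum
    using that by (auto intro!: pol_carrier_sum pol_carrier_closed simp: jet_vars_def)
  then show ?thesis
    using assms by (auto simp: jet_matrix_def intro: coeffs_in_closed)
qed

lemma coeff_pf_jet_matrix_in:
  "set L \<subseteq> {1..n} \<Longrightarrow> coeff (pf (jet_matrix k) L) h \<in> pol_carrier (jet_vars n k)"
  using coeffs_in_pf[of L "jet_vars n k" "jet_matrix k"] coeffs_in_jet_matrix
  unfolding coeffs_in_def by blast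

lemma pfaffian_comp_eq_pf: "pfaffian r (\<lambda>i j. B (a i) (a j)) = pf B (map a [1..<2*r+1])"
  by (simp only: pfaffian_eq_pf pf_map)

text \<open>An increasing selection amounts to the sorted list of its values. Rows start at 1 and
  list positions at 0, whence \<open>i - 1\<close> in \<open>?a\<close>.\<close>

lemma jet_pfaffians_eq:
  "jet_pfaffians n k r =
     {pf (jet_matrix k) L |L. sorted_wrt (<) L \<and> length L = 2*r \<and> set L \<subseteq> {1..n}}"
proof (intro equalityI subsetI)
  fix p assume "p \<in> jet_pfaffians n k r"
  then obtain a where a: "strict_mono_on {1..2*r} a" "a ` {1..2*r} \<subseteq> {1..n}"
    and p: "p = pfaffian r (\<lambda>i j. jet_matrix k (a i) (a j))"
    unfolding jet_pfaffians_def by blast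
  let ?L = "map a [1..<2*r+1]"
  have "p = pf (jet_matrix k) ?L"
    unfolding p by (rule pfaffian_comp_eq_pf)
  moreover have "set ?L \<subseteq> {1..n}" using a(2) by (auto simp del: upt_Suc)
  moreover have "sorted_wrt (<) ?L"
    using a(1) by (auto simp: sorted_wrt_iff_nth_less strict_mono_on_def simp del: upt_Suc)
  moreover have "length ?L = 2*r" by simp
  ultimately show "p \<in> {pf (jet_matrix k) L |L. sorted_wrt (<) L \<and> length L = 2*r \<and> set L \<subseteq> {1..n}}"
    by blast
next
  fix p assume "p \<in> {pf (jet_matrix k) L |L. sorted_wrt (<) L \<and> length L = 2*r \<and> set L \<subseteq> {1..n}}"
  then obtain L where L: "sorted_wrt (<) L" "length L = 2*r" "set L \<subseteq> {1..n}"
    and p: "p = pf (jet_matrix k) L"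
    by blast
  let ?a = "\<lambda>i. L ! (i - 1)"
  have L_eq: "map ?a [1..<2*r+1] = L"
    using L(2) by (intro nth_equalityI) (simp_all del: upt_Suc)
  have "p = pfaffian r (\<lambda>i j. jet_matrix k (?a i) (?a j))"
    unfolding p pfaffian_comp_eq_pf[of r "jet_matrix k" ?a] L_eq ..
  moreover have "strict_mono_on {1..2*r} ?a"
    using L(1,2) by (auto simp: sorted_wrt_iff_nth_less intro!: strict_mono_onI)
  moreover have "?a ` {1..2*r} \<subseteq> {1..n}"
  proof
    fix y assume "y \<in> ?a ` {1..2*r}"
    then obtain i where "i \<in> {1..2*r}" "y = L ! (i - 1)" by blast
    moreover have "i - 1 < length L" using calculation(1) L(2) by auto
    ultimately have "y \<in> set L" by simp
    then show "y \<in> {1..n}" using L(3) by blast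
  qed
  ultimately show "p \<in> jet_pfaffians n k r"
    unfolding jet_pfaffians_def by (intro CollectI exI[of _ ?a] conjI)
qed

text \<open>The generators suffice to cut out the zero locus, evaluation commutes with
  \<open>pf\<close>, and the vanishing of all coefficients below \<open>k\<close> is divisibility by
  \<open>t^k\<close>.\<close>

lemma pfaffian_jet_variety_iff:
  fixes x :: "nat \<times> nat \<times> nat \<Rightarrow> 'a::comm_ring_1"
  shows "x \<in> pfaffian_jet_variety n k r \<longleftrightarrow> x \<in> affine_space (jet_vars n k) \<and>
     (\<forall>L. sorted_wrt (<) L \<longrightarrow> length L = 2*r \<longrightarrow> set L \<subseteq> {1..n} \<longrightarrow>
        monom 1 k dvd pf (jet_value k x) L)"
proof -
  let ?S = "{coeff p h |p h. p \<in> jet_pfaffians n k r \<and> h < k} :: (nat \<times> nat \<times> nat, 'a) mpol set"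
  let ?A = "{(L, h). sorted_wrt (<) L \<and> length L = 2*r \<and> set L \<subseteq> {1..n} \<and> h < k}"
  have S: "?S = (\<lambda>(L, h). coeff (pf (jet_matrix k) L) h) ` ?A"
    unfolding jet_pfaffians_eq by (auto simp del: atLeastAtMost_iff)
  have "?S \<subseteq> pol_carrier (jet_vars n k)"
    unfolding S by (auto simp del: atLeastAtMost_iff intro!: coeff_pf_jet_matrix_in)
  then have "pfaffian_jet_variety n k r = zero_locus (jet_vars n k) ?S"
    unfolding pfaffian_jet_variety_def pfaffian_jet_ideal_def by (rule zero_locus_genideal)
  then have "x \<in> pfaffian_jet_variety n k r \<longleftrightarrow>
      x \<in> affine_space (jet_vars n k) \<and> (\<forall>p\<in>?S. pol_value x p = 0)"
    by (simp only: zero_locus_def mem_Collect_eq)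
  also have "(\<forall>p\<in>?S. pol_value x p = 0) \<longleftrightarrow>
      (\<forall>(L, h)\<in>?A. coeff (pf (jet_value k x) L) h = 0)"
    unfolding S by (simp add: pf_jet_value case_prod_unfold)
  finally show ?thesis
    unfolding monom_1_dvd_iff' by (auto simp del: atLeastAtMost_iff)
qed

text \<open>The set \<open>H\<close> is arbitrary so as to cover both an order condition, with
  \<open>H\<close> an initial segment, and the vanishing of a single coefficient.\<close>

lemma closedin_pfaffian_jet_variety:
  fixes P :: "(nat \<times> nat \<times> nat \<Rightarrow> 'a::field) set"
  assumes "P = pfaffian_jet_variety n k r" and "set L \<subseteq> {1..n}"
  shows "closedin (subtopology (zariski (jet_vars n k)) P)
           {x \<in> P. \<forall>h\<in>H. coeff (pf (jet_value k x) L) h = 0}"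
proof -
  let ?S = "{coeff (pf (jet_matrix k) L) h :: (nat \<times> nat \<times> nat, 'a) mpol |h. h \<in> H}"
  have "?S \<subseteq> pol_carrier (jet_vars n k)"
    using coeff_pf_jet_matrix_in[OF assms(2)] by blast
  then have "closedin (zariski (jet_vars n k)) (zero_locus (jet_vars n k) ?S)"
    unfolding closedin_zariski by blast
  moreover have "{x \<in> P. \<forall>h\<in>H. coeff (pf (jet_value k x) L) h = 0} = zero_locus (jet_vars n k) ?S \<inter> P"
    unfolding assms(1) by (auto simp: zero_locus_def pfaffian_jet_variety_iff pf_jet_value)
  ultimately show ?thesis
    unfolding closedin_subtopology by blast
qed

lemma monom_dvd_pf_mult_pf:
  fixes x :: "nat \<times> nat \<times> nat \<Rightarrow> 'a::field"
  assumes x: "x \<in> pfaffian_jet_variety n k r" and n: "2 * r + 2 \<le> n" and r: "1 \<le> r"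
  shows "monom 1 (2 * k) dvd
    pf (jet_value k x) [5..<2*r+3] * pf (jet_value k x) [1..<2*r+3]"
proof -
  let ?B = "jet_value k x" and ?I = "[5..<2*r+3]"
  \<comment> \<open>\<open>?I\<close> has \<open>2*r - 2\<close> entries, so two labels from 1 to 4
    complete it to an index list of a \<open>2r\<close>-pfaffian. All six factors on the right of
    the Pluecker relation have this form.\<close>
  have dvd: "monom 1 k dvd pf ?B (p # q # ?I)" if "1 \<le> p" "p < q" "q \<le> 4" for p q
  proof -
    have "length (p # q # ?I) = 2*r" using r by (simp add: add.commute del: upt_Suc)
    moreover have "sorted_wrt (<) (p # q # ?I)"
      using that by (simp del: upt_Suc)
    moreover have "set (p # q # ?I) \<subseteq> {1..n}"
      using that n r by (auto simp del: upt_Suc)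
    ultimately show ?thesis
      using x unfolding pfaffian_jet_variety_iff by blast
  qed
  have full: "[1..<2*r+3] = 1 # 2 # 3 # 4 # ?I"
  proof -
    have "[1..<2*r+3] = [1..<5] @ ?I"
      using upt_add_eq_append[of 1 5 "2*r-2"] r by (simp add: add.commute del: upt_Suc)
    moreover have "[1..<5] = [1, 2, 3, 4::nat]"
      by (simp add: numeral_eq_Suc)
    ultimately show ?thesis by simp
  qed
  have monom: "monom 1 (2 * k) = monom 1 k * (monom 1 k :: 'a poly)"
    by (simp add: mult_monom mult_2)
  show ?thesis
    unfolding full monom pf_plucker[OF skew_jet_value]
    by (intro dvd_add dvd_diff mult_dvd_mono dvd) simp_all
qed

section \<open>Block diagonal points\<close>

text \<open>The order in \<open>t\<close> of the block whose first row is \<open>i\<close>. For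
  \<open>2 * d \<le> k\<close> and \<open>2 \<le> r\<close>, the total over all blocks is
  \<open>2 * k - d\<close>, the blocks from row 5 on total \<open>d\<close>, and any
  \<open>r\<close> of the \<open>r + 1\<close> blocks total at least \<open>k\<close>.\<close>

definition block_weight :: "nat \<Rightarrow> nat \<Rightarrow> nat \<Rightarrow> nat" where
  "block_weight k d i = (if i = 1 \<or> i = 3 then k - d else if i = 5 then d else 0)"

text \<open>For \<open>d = 0\<close> the first two blocks have weight \<open>k\<close>, so that they vanish.\<close>

definition block_point :: "nat \<Rightarrow> nat \<Rightarrow> nat \<Rightarrow> nat \<Rightarrow> nat \<times> nat \<times> nat \<Rightarrow> 'a::field" where
  "block_point n k r d = (\<lambda>(i, j, h)\<in>jet_vars n k.
     if odd i \<and> j = i + 1 \<and> i \<le> 2*r+1 \<and> h = block_weight k d i then 1 else 0)"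

lemma jet_value_block_point:
  assumes "1 \<le> i" "i < j" "j \<le> n"
  shows "jet_value k (block_point n k r d) i j =
    (if odd i \<and> j = i + 1 \<and> i \<le> 2*r+1 \<and> block_weight k d i < k then monom 1 (block_weight k d i) else 0)"
  using assms by (auto simp: poly_eq_iff coeff_jet_value block_point_def jet_vars_def)

text \<open>Exactly one block is omitted. The total is \<open>2 * k - d\<close>, and no block weighs
  more than \<open>k - d\<close> because \<open>d \<le> k - d\<close>.\<close>

lemma block_weight_sum_ge:
  assumes "inj_on b {1..r}" and b: "b ` {1..r} \<subseteq> {i. odd i \<and> i \<le> 2*r+1}"
    and "2 * d \<le> k" and "2 \<le> r"
  shows "k \<le> (\<Sum>i=1..r. block_weight k d (b i))"
proof -
  let ?O = "{i. odd i \<and> i \<le> 2*r+(1::nat)}" and ?w = "block_weight k d"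
  have O: "?O = (\<lambda>i. 2 * i + 1) ` {..r}"
    by (auto elim!: oddE)
  have fin: "finite ?O" unfolding O by simp
  have "card ?O = r + 1"
    unfolding O by (subst card_image) (auto simp: inj_on_def)
  moreover have "card (b ` {1..r}) = r" using assms(1) by (simp add: card_image)
  ultimately have "card (?O - b ` {1..r}) = 1"
    using fin b by (subst card_Diff_subset) auto
  then obtain e where e: "?O - b ` {1..r} = {e}" by (rule card_1_singletonE)
  have "sum ?w ?O = sum ?w {1, 3, 5}"
    using \<open>2 \<le> r\<close> fin by (intro sum.mono_neutral_right) (auto simp: block_weight_def)
  then have "sum ?w ?O = 2 * (k - d) + d" by (simp add: block_weight_def)
  moreover have "sum ?w ?O = sum ?w (b ` {1..r}) + sum ?w {e}"
    using sum.subset_diff[OF b fin, of ?w] e by simp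
  moreover have "?w e \<le> k - d" using \<open>2 * d \<le> k\<close> by (auto simp: block_weight_def)
  ultimately have "k \<le> sum ?w (b ` {1..r})" using \<open>2 * d \<le> k\<close> by simp
  then show ?thesis using assms(1) by (simp add: sum.reindex)
qed

text \<open>The matching sum is used rather than \<open>pf\<close> because the divisibility holds
  term by term: a nonzero term is, up to sign, a product of entries from \<open>r\<close> distinct
  blocks.\<close>

lemma block_point_in_variety:
  assumes d: "2 * d \<le> k" and r: "2 \<le> r"
  shows "(block_point n k r d :: _ \<Rightarrow> 'a::field) \<in> pfaffian_jet_variety n k r"
  unfolding pfaffian_jet_variety_iff
proof (intro conjI allI impI)
  let ?x = "block_point n k r d :: _ \<Rightarrow> 'a"
  show "?x \<in> affine_space (jet_vars n k)"
    by (auto simp: affine_space_def block_point_def)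
  fix L :: "nat list" assume L: "sorted_wrt (<) L" "length L = 2*r" "set L \<subseteq> {1..n}"
  define a where "a = (\<lambda>i. L ! (i - 1))"
  have L_eq: "L = map a [1..<2*r+1]"
    using L(2) by (intro nth_equalityI) (simp_all add: a_def del: upt_Suc)
  have a: "a i < a j" if "1 \<le> i" "i < j" "j \<le> 2*r" for i j
    using L(1,2) that by (auto simp: a_def sorted_wrt_iff_nth_less)
  have a_in: "a i \<in> {1..n}" if "i \<in> {1..2*r}" for i
  proof -
    have "i - 1 < length L" using that L(2) by auto
    then have "a i \<in> set L" unfolding a_def by (rule nth_mem)
    then show ?thesis using L(3) by blast
  qed
  have eq: "pf (jet_value k ?x) L = pfaffian r (\<lambda>i j. jet_value k ?x (a i) (a j))"
    unfolding L_eq by (rule pfaffian_comp_eq_pf[symmetric])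
  have "monom 1 k dvd
      of_int (sign \<sigma>) * (\<Prod>i=1..r. jet_value k ?x (a (\<sigma> (2*i-1))) (a (\<sigma> (2*i))))"
    if \<sigma>: "\<sigma> permutes {1..2*r}" "\<forall>i\<in>{1..r}. \<sigma> (2*i-1) < \<sigma> (2*i)" for \<sigma>
  proof -
    \<comment> \<open>If the factor \<open>?f i\<close> is nonzero, \<open>b i\<close> is the first
      row of the block it comes from.\<close>
    define b where "b = (\<lambda>i. a (\<sigma> (2*i-1)))"
    let ?f = "\<lambda>i. jet_value k ?x (b i) (a (\<sigma> (2*i)))"
    have "monom 1 k dvd (\<Prod>i=1..r. ?f i)"
    proof (cases "\<forall>i\<in>{1..r}. ?f i \<noteq> 0")
      case True
      have f: "odd (b i) \<and> b i \<le> 2*r+1 \<and> ?f i = monom 1 (block_weight k d (b i))"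
        if i: "i \<in> {1..r}" for i
      proof -
        have "2*i-1 \<in> {1..2*r}" "2*i \<in> {1..2*r}" using i by auto
        then have in_range: "\<sigma> (2*i-1) \<in> {1..2*r}" "\<sigma> (2*i) \<in> {1..2*r}"
          using permutes_in_image[OF \<sigma>(1)] by blast+
        then have "1 \<le> b i" "b i < a (\<sigma> (2*i))" "a (\<sigma> (2*i)) \<le> n"
          using a[of "\<sigma> (2*i-1)" "\<sigma> (2*i)"] \<sigma>(2) i a_in by (auto simp: b_def)
        from jet_value_block_point[OF this, of k r d, where 'a = 'a] True i show ?thesis
          by (auto split: if_splits)
      qed
      have "inj_on b {1..r}"
      proof (rule linorder_inj_onI)
        fix i j assume ij: "i < j" "i \<in> {1..r}" "j \<in> {1..r}"
        then have "2*i-1 \<noteq> 2*j-1" by auto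
        then have "\<sigma> (2*i-1) \<noteq> \<sigma> (2*j-1)"
          using permutes_inj[OF \<sigma>(1)] by (simp add: inj_eq)
        moreover have "2*i-1 \<in> {1..2*r}" "2*j-1 \<in> {1..2*r}" using ij by auto
        then have "\<sigma> (2*i-1) \<in> {1..2*r}" "\<sigma> (2*j-1) \<in> {1..2*r}"
          using permutes_in_image[OF \<sigma>(1)] by blast+
        ultimately show "b i \<noteq> b j"
          using a[of "\<sigma> (2*i-1)" "\<sigma> (2*j-1)"] a[of "\<sigma> (2*j-1)" "\<sigma> (2*i-1)"]
          unfolding b_def by (metis atLeastAtMost_iff linorder_neq_iff order_less_irrefl)
      qed auto
      moreover have "b ` {1..r} \<subseteq> {i. odd i \<and> i \<le> 2*r+1}" using f by blast
      ultimately have "k \<le> (\<Sum>i=1..r. block_weight k d (b i))"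
        using d r by (rule block_weight_sum_ge)
      moreover have "(\<Prod>i=1..r. ?f i) = monom 1 (\<Sum>i=1..r. block_weight k d (b i))"
      proof -
        have "(\<Prod>i\<in>A. monom (1::'a) (g i)) = monom 1 (sum g A)" for A and g :: "nat \<Rightarrow> nat"
          by (induction A rule: infinite_finite_induct) (simp_all add: mult_monom)
        moreover have "(\<Prod>i=1..r. ?f i) = (\<Prod>i=1..r. monom 1 (block_weight k d (b i)))"
          using f by (intro prod.cong) auto
        ultimately show ?thesis by simp
      qed
      ultimately show ?thesis by (simp add: monom_1_dvd_iff')
    next
      case False
      then have "(\<Prod>i=1..r. ?f i) = 0" by (intro prod_zero) auto
      then show ?thesis by (simp only: dvd_0_right)
    qed
    then show ?thesis unfolding b_def by (rule dvd_mult)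
  qed
  then show "monom 1 k dvd pf (jet_value k ?x) L"
    unfolding eq pfaffian_def by (intro dvd_sum) simp
qed

text \<open>Since \<open>s\<close> is odd, the list starts at the first row of a block. Weights
  below \<open>k\<close> ensure that each block entry is a monomial instead of zero.\<close>

lemma pf_block_point:
  assumes "odd s" and n: "s + 2 * m \<le> n + 1" and le: "s + 2 * m \<le> 2 * r + 3"
    and less: "\<And>i. i < m \<Longrightarrow> block_weight k d (s + 2 * i) < k"
  shows "pf (jet_value k (block_point n k r d :: _ \<Rightarrow> 'a::field)) [s..<s + 2 * m] =
    monom 1 (\<Sum>i<m. block_weight k d (s + 2 * i))"
proof -
  let ?B = "jet_value k (block_point n k r d :: _ \<Rightarrow> 'a)"
  have "1 \<le> s" using \<open>odd s\<close> by (cases s) auto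
  have "pf ?B [s..<s + 2 * m] = (\<Prod>i<m. ?B (s + 2 * i) (s + 2 * i + 1))"
  proof (rule pf_upt_block_diagonal)
    fix i z assume "i < m" "s + 2 * i + 1 < z" "z < s + 2 * m"
    then show "?B (s + 2 * i) z = 0"
      using \<open>1 \<le> s\<close> n by (subst jet_value_block_point) auto
  qed
  also have "\<dots> = (\<Prod>i<m. monom 1 (block_weight k d (s + 2 * i)))"
  proof (rule prod.cong)
    fix i assume "i \<in> {..<m}"
    then show "?B (s + 2 * i) (s + 2 * i + 1) = monom 1 (block_weight k d (s + 2 * i))"
      using \<open>1 \<le> s\<close> \<open>odd s\<close> n le less[of i] by (subst jet_value_block_point) auto
  qed simp
  also have "\<dots> = monom 1 (\<Sum>i<m. block_weight k d (s + 2 * i))"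
    by (induction m) (simp_all add: mult_monom)
  finally show ?thesis .
qed

section \<open>Separation of the block diagonal points and the count of components\<close>

theorem corollary4p10:
  fixes n k r :: nat and P :: "(nat \<times> nat \<times> nat \<Rightarrow> 'a::alg_closed_field) set"
  assumes "k \<ge> 1" and "r \<ge> 2" and "n \<ge> 2 * r + 4"
    and P_def: "P = pfaffian_jet_variety n k r"
  shows "\<exists>\<C> \<subseteq> irreducible_components_of (subtopology (zariski (jet_vars n k)) P).
           finite \<C> \<and> card \<C> = k div 2 + 1"
proof (rule card_irreducible_components_ge)
  let ?p = "\<lambda>d. block_point n k r d :: nat \<times> nat \<times> nat \<Rightarrow> 'a"
  let ?I = "[5..<2*r+3]" and ?J = "[1..<2*r+3]"
  let ?X = "subtopology (zariski (jet_vars n k)) P"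
  have top: "topspace ?X = P"
    unfolding P_def by (auto simp: topspace_zariski pfaffian_jet_variety_iff)
  show "?p d \<in> topspace ?X" if "d \<le> k div 2" for d
    unfolding top unfolding P_def using that \<open>r \<ge> 2\<close> by (intro block_point_in_variety) auto
  fix d e assume ed: "e < d" "d \<le> k div 2"
  let ?C = "{x \<in> P. \<forall>h\<in>{..<d}. coeff (pf (jet_value k x) ?I) h = 0}"
  let ?D = "{x \<in> P. \<forall>h\<in>{2 * k - d}. coeff (pf (jet_value k x) ?J) h = 0}"
  have sub: "set ?I \<subseteq> {1..n}" "set ?J \<subseteq> {1..n}"
    using assms by (auto simp del: upt_Suc)
  have "closedin ?X ?C" "closedin ?X ?D"
    by (rule closedin_pfaffian_jet_variety[OF P_def sub(1)] closedin_pfaffian_jet_variety[OF P_def sub(2)])+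
  moreover have "P \<subseteq> ?C \<union> ?D"
  proof
    fix x assume "x \<in> P"
    then have dvd: "monom 1 (2 * k) dvd pf (jet_value k x) ?I * pf (jet_value k x) ?J"
      unfolding P_def using assms by (intro monom_dvd_pf_mult_pf) auto
    show "x \<in> ?C \<union> ?D"
    proof (cases "x \<in> ?C")
      case False
      then obtain h where "h < d" "coeff (pf (jet_value k x) ?I) h \<noteq> 0"
        using \<open>x \<in> P\<close> by blast
      then have "coeff (pf (jet_value k x) ?J) (2 * k - d) = 0"
        using ed by (intro coeff_zero_of_monom_dvd_mult[OF dvd]) auto
      then show ?thesis using \<open>x \<in> P\<close> by blast
    qed blast
  qed
  moreover have "?p e \<notin> ?C"
  proof -
    \<comment> \<open>The list \<open>?I\<close> covers \<open>r - 1\<close> blocks. Writing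
      \<open>r - 1\<close> as \<open>Suc m\<close> splits off the block at row 5, the only one among
      them whose weight may be nonzero.\<close>
    obtain m where m: "r = Suc (Suc m)" using le_Suc_ex[OF \<open>r \<ge> 2\<close>] by auto
    have "pf (jet_value k (?p e)) [5..<5 + 2 * Suc m] = monom 1 (\<Sum>i<Suc m. block_weight k e (5 + 2 * i))"
      using ed assms m by (intro pf_block_point) (auto simp: block_weight_def)
    also have "(\<Sum>i<Suc m. block_weight k e (5 + 2 * i)) = e"
      by (simp add: sum.lessThan_Suc_shift block_weight_def del: sum.lessThan_Suc)
    also have "5 + 2 * Suc m = 2 * r + 3" using m by simp
    finally show ?thesis using ed by (auto simp del: upt_Suc)
  qed
  moreover have "?p d \<notin> ?D"
  proof -
    obtain m where m: "r = Suc (Suc m)" using le_Suc_ex[OF \<open>r \<ge> 2\<close>] by auto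
    have "pf (jet_value k (?p d)) [1..<1 + 2 * Suc r] = monom 1 (\<Sum>i<Suc r. block_weight k d (1 + 2 * i))"
      \<comment> \<open>From \<open>e < d\<close> follows \<open>d > 0\<close>, so the first two
        blocks have weight \<open>k - d < k\<close> and do not vanish.\<close>
      using ed assms by (intro pf_block_point) (auto simp: block_weight_def)
    also have "(\<Sum>i<Suc r. block_weight k d (1 + 2 * i)) = 2 * k - d"
      unfolding m using ed by (simp add: sum.lessThan_Suc_shift block_weight_def del: sum.lessThan_Suc)
    also have "1 + 2 * Suc r = 2 * r + 3" by simp
    finally show ?thesis by (auto simp del: upt_Suc)
  qed
  ultimately show "\<exists>C D. closedin ?X C \<and> closedin ?X D \<and> topspace ?X \<subseteq> C \<union> D \<and> ?p e \<notin> C \<and> ?p d \<notin> D"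
    unfolding top by blast
qed

end
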